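(* Let $C_n$ be a generic $n$-rosette. Then: (i) the number of smooth branches of $\mathrm{CSS}(C_n)$ is equal to $n$; (ii) exactly one smooth branch of $\mathrm{CSS}(C_n)$ has an odd number of cusps; (iii) $n-1$ smooth branches of $\mathrm{CSS}(C_n)$ have integer rotation number and one branch has half-integer rotation number; (iv) exactly $\lfloor n/2\rfloor$ smooth branches of $\mathrm{CSS}(C_n)$ have asymptotes; (v) the number of cusp singularities of a smooth branch of $\mathrm{CSS}(C_n)$ which does not have an asymptote is not smaller than the number of cusp singularities of the smooth branch of the Wigner caustic of $C_n$ generated by the same family of parallel pairs.
   Context: An $n$-rosette is a closed regular curve with nowhere vanishing curvature and rotation number $n$. Generic: the parameterization $f:S^1\to\mathbb{R}^2$ is regular with only transversal self-crossings and satisfies non-degeneracy conditions on parallel pairs (e.g. if $\kappa'(s_1)\kappa^2(s_2)=\kappa^2(s_1)\kappa'(s_2)$ at a parallel pair then $\kappa''(s_1)\kappa^3(s_2)\ne\kappa^3(s_1)\kappa''(s_2)$, where sums $\kappa(s_1)-\operatorname{sgn}\langle f'(s_1),f'(s_2)\rangle\kappa(s_2)$ vanish the previous equality fails, no two distinct parallel pairs with vanishing such sums share a chord, and self-intersections of the CSS are transversal). Distinct points form a parallel pair if their tangent lines are parallel. $\mathrm{CSS}(C_n)$ is the envelope of lines through parallel pairs; it consists of double tangents and curves that are images of continuous families of parallel pairs $(a,b)$ under $\pi_{\mathrm{CSS}}(a,b)=\frac{\kappa(a)a+\kappa(b)b}{\kappa(a)+\kappa(b)}$ (curvatures w.r.t.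 local arc-length parameterizations oriented oppositely at $a$ and $b$); where $\kappa(a)+\kappa(b)=0$ the line through $a,b$ is an asymptote. Maximal such curves are smooth semi-branches, those sharing an asymptote are joined, giving smooth branches. The Wigner caustic is $\{(a+b)/2: a,b \text{ parallel pair}\}$; its smooth branches are images of the same families of parallel pairs under $(a,b)\mapsto (a+b)/2$. The rotation number of a curve with cusps is the rotation number of its continuous unit normal field (an integer or half-integer). *)

theory Defs
  imports "HOL-Complex_Analysis.Complex_Analysis"
begin

text \<open>Plane = complex numbers.  The parameter circle S^1 is R/Z: a closed curve is a
  1-periodic map f :: real => complex; the point of S^1 represented by t is ecirc t.\<close>

definition ecirc :: "real \<Rightarrow> complex" where
  "ecirc t = cis (2 * pi * t)"

definition D :: "(real \<Rightarrow> 'a::real_normed_vector) \<Rightarrow> real \<Rightarrow> 'a" where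
  "D g = (\<lambda>t. vector_derivative g (at t))"

definition smooth_fun :: "(real \<Rightarrow> 'a::real_normed_vector) \<Rightarrow> bool" where
  "smooth_fun g \<longleftrightarrow> (\<forall>k t. ((D ^^ k) g has_vector_derivative (D ^^ Suc k) g t) (at t))"

definition curv :: "(real \<Rightarrow> complex) \<Rightarrow> real \<Rightarrow> real" where
  "curv f t = Im (cnj (D f t) * D (D f) t) / cmod (D f t) ^ 3"

definition arcD :: "(real \<Rightarrow> complex) \<Rightarrow> (real \<Rightarrow> real) \<Rightarrow> real \<Rightarrow> real" where
  "arcD f g t = D g t / cmod (D f t)"

definition curv1 :: "(real \<Rightarrow> complex) \<Rightarrow> real \<Rightarrow> real" where
  "curv1 f = arcD f (curv f)"

definition curv2 :: "(real \<Rightarrow> complex) \<Rightarrow> real \<Rightarrow> real" where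
  "curv2 f = arcD f (arcD f (curv f))"

definition parallel_pair :: "(real \<Rightarrow> complex) \<Rightarrow> real \<Rightarrow> real \<Rightarrow> bool" where
  "parallel_pair f s t \<longleftrightarrow> ecirc s \<noteq> ecirc t \<and> Im (D f s * cnj (D f t)) = 0"

definition tsgn :: "(real \<Rightarrow> complex) \<Rightarrow> real \<Rightarrow> real \<Rightarrow> real" where
  "tsgn f s t = sgn (Re (D f s * cnj (D f t)))"

text \<open>kappa(a) + kappa(b) w.r.t. oppositely oriented local parameterisations\<close>
definition ksum :: "(real \<Rightarrow> complex) \<Rightarrow> real \<Rightarrow> real \<Rightarrow> real" where
  "ksum f s t = curv f s - tsgn f s t * curv f t"

definition css :: "(real \<Rightarrow> complex) \<Rightarrow> real \<Rightarrow> real \<Rightarrow> complex" where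
  "css f s t = (let ka = curv f s; kb = - tsgn f s t * curv f t
                in (of_real ka * f s + of_real kb * f t) / of_real (ka + kb))"

definition wigner :: "(real \<Rightarrow> complex) \<Rightarrow> real \<Rightarrow> real \<Rightarrow> complex" where
  "wigner f s t = (f s + f t) / 2"

definition on_line :: "complex \<Rightarrow> complex \<Rightarrow> complex \<Rightarrow> bool" where
  "on_line a b p \<longleftrightarrow> Im ((p - a) * cnj (b - a)) = 0"

definition rosette :: "(real \<Rightarrow> complex) \<Rightarrow> nat \<Rightarrow> bool" where
  "rosette f n \<longleftrightarrow> smooth_fun f \<and> (\<forall>t. f (t + 1) = f t) \<and> (\<forall>t. D f t \<noteq> 0)
     \<and> (\<forall>t. curv f t \<noteq> 0) \<and> winding_number (D f) 0 = of_nat n"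

definition generic_rosette :: "(real \<Rightarrow> complex) \<Rightarrow> nat \<Rightarrow> bool" where
  "generic_rosette f n \<longleftrightarrow> rosette f n
   \<comment> \<open>only transversal self-crossings\<close>
   \<and> (\<forall>s t. ecirc s \<noteq> ecirc t \<and> f s = f t \<longrightarrow> Im (D f s * cnj (D f t)) \<noteq> 0)
   \<comment> \<open>non-degeneracy conditions on parallel pairs\<close>
   \<and> (\<forall>s t. parallel_pair f s t \<and> curv1 f s * curv f t ^ 2 = curv f s ^ 2 * curv1 f t
        \<longrightarrow> curv2 f s * curv f t ^ 3 \<noteq> curv f s ^ 3 * curv2 f t)
   \<and> (\<forall>s t. parallel_pair f s t \<and> ksum f s t = 0
        \<longrightarrow> curv1 f s * curv f t ^ 2 \<noteq> curv f s ^ 2 * curv1 f t)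
   \<and> (\<forall>s t s' t'. parallel_pair f s t \<and> parallel_pair f s' t' \<and> ksum f s t = 0 \<and> ksum f s' t' = 0
        \<and> {ecirc s, ecirc t} \<noteq> {ecirc s', ecirc t'}
        \<longrightarrow> \<not> (on_line (f s) (f t) (f s') \<and> on_line (f s) (f t) (f t')))
   \<comment> \<open>self-intersections of the CSS are transversal\<close>
   \<and> (\<forall>s t s' t'. parallel_pair f s t \<and> parallel_pair f s' t' \<and> ksum f s t \<noteq> 0 \<and> ksum f s' t' \<noteq> 0
        \<and> {ecirc s, ecirc t} \<noteq> {ecirc s', ecirc t'} \<and> css f s t = css f s' t'
        \<longrightarrow> Im ((f t - f s) * cnj (f t' - f s')) \<noteq> 0)"

text \<open>The space of (ordered) parallel pairs on the torus S^1 x S^1; a smooth branch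
  is a maximal continuous family of (unordered) parallel pairs, i.e. a connected
  component together with its image under swapping.\<close>
definition pp_set :: "(real \<Rightarrow> complex) \<Rightarrow> (complex \<times> complex) set" where
  "pp_set f = {(ecirc s, ecirc t) | s t. parallel_pair f s t}"

definition branches :: "(real \<Rightarrow> complex) \<Rightarrow> (complex \<times> complex) set set" where
  "branches f = {C \<union> prod.swap ` C | C. C \<in> components (pp_set f)}"

definition traversal :: "(real \<Rightarrow> complex) \<Rightarrow> (complex \<times> complex) set \<Rightarrow> (real \<Rightarrow> real \<times> real) \<Rightarrow> bool" where
  "traversal f B \<gamma> \<longleftrightarrow>
     (let P = (\<lambda>u. (ecirc (fst (\<gamma> u)), ecirc (snd (\<gamma> u)))) in
       (\<forall>u\<in>{0..1}. \<gamma> differentiable (at u) \<and> D \<gamma> u \<noteq> 0 \<and> P u \<in> B)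
     \<and> (P 1 = P 0 \<or> P 1 = prod.swap (P 0))
     \<and> (\<forall>u\<in>{0..<1}. \<forall>v\<in>{0..<1}. u \<noteq> v \<longrightarrow> P u \<noteq> P v \<and> P u \<noteq> prod.swap (P v))
     \<and> B \<subseteq> P ` {0..1} \<union> prod.swap ` P ` {0..1})"

definition trav :: "(real \<Rightarrow> complex) \<Rightarrow> (complex \<times> complex) set \<Rightarrow> real \<Rightarrow> real \<times> real" where
  "trav f B = (SOME \<gamma>. traversal f B \<gamma>)"

definition css_cusps :: "(real \<Rightarrow> complex) \<Rightarrow> (real \<Rightarrow> real \<times> real) \<Rightarrow> real set" where
  "css_cusps f \<gamma> = {u \<in> {0..<1}. ksum f (fst (\<gamma> u)) (snd (\<gamma> u)) \<noteq> 0
        \<and> D (\<lambda>v. css f (fst (\<gamma> v)) (snd (\<gamma> v))) u = 0}"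

definition wc_cusps :: "(real \<Rightarrow> complex) \<Rightarrow> (real \<Rightarrow> real \<times> real) \<Rightarrow> real set" where
  "wc_cusps f \<gamma> = {u \<in> {0..<1}. D (\<lambda>v. wigner f (fst (\<gamma> v)) (snd (\<gamma> v))) u = 0}"

definition css_cusp_count :: "(real \<Rightarrow> complex) \<Rightarrow> (complex \<times> complex) set \<Rightarrow> nat" where
  "css_cusp_count f B = card (css_cusps f (trav f B))"

definition wc_cusp_count :: "(real \<Rightarrow> complex) \<Rightarrow> (complex \<times> complex) set \<Rightarrow> nat" where
  "wc_cusp_count f B = card (wc_cusps f (trav f B))"

text \<open>continuous unit normal field cis (phi u) along the CSS branch (orthogonal to the
  velocity wherever the branch point is finite), and the resulting rotation number\<close>
definition normal_lift :: "(real \<Rightarrow> complex) \<Rightarrow> (real \<Rightarrow> real \<times> real) \<Rightarrow> (real \<Rightarrow> real) \<Rightarrow> bool" where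
  "normal_lift f \<gamma> \<phi> \<longleftrightarrow> continuous_on {0..1} \<phi> \<and>
     (\<forall>u\<in>{0..1}. ksum f (fst (\<gamma> u)) (snd (\<gamma> u)) \<noteq> 0 \<longrightarrow>
        Re (cnj (cis (\<phi> u)) * D (\<lambda>v. css f (fst (\<gamma> v)) (snd (\<gamma> v))) u) = 0)"

definition css_rot :: "(real \<Rightarrow> complex) \<Rightarrow> (complex \<times> complex) set \<Rightarrow> real" where
  "css_rot f B = (let \<gamma> = trav f B; \<phi> = (SOME \<phi>. normal_lift f \<gamma> \<phi>)
                  in (\<phi> 1 - \<phi> 0) / (2 * pi))"

definition has_asymptote :: "(real \<Rightarrow> complex) \<Rightarrow> (complex \<times> complex) set \<Rightarrow> bool" where
  "has_asymptote f B \<longleftrightarrow> (\<exists>s t. (ecirc s, ecirc t) \<in> B \<and> ksum f s t = 0)"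

end

theory Submission
  imports Defs "HOL-Library.Real_Mod" "HOL-Number_Theory.Cong"
begin

text \<open>
  Since the curvature never vanishes, the tangent angle \<open>\<theta>\<close> is a diffeomorphism of the line with
  \<open>\<theta> (t + 1) = \<theta> t + 2 \<pi> n\<close>. Two points form a parallel pair iff their angles differ by \<open>m \<pi>\<close> with
  \<open>2 n\<close> not dividing \<open>m\<close>, so the ordered parallel pairs form \<open>2 n - 1\<close> disjoint circles; swapping
  exchanges \<open>m\<close> and \<open>2 n - m\<close>, which leaves \<open>n\<close> branches, the one with \<open>m = n\<close> being swapped into itself.

  Let \<open>\<kappa> x\<close> be the curvature at angle \<open>x\<close> and put \<open>G x = ln \<kappa>(x + m \<pi>) - ln \<kappa>(x)\<close>. The velocity of the
  centre symmetry set is a multiple of \<open>G' x\<close> times the chord of the pair, so its cusps are the zeros of \<open>G'\<close>,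
  which are simple by genericity. An asymptote occurs iff \<open>m\<close> is even and \<open>G\<close> vanishes, which it does because the
  periodic function \<open>ln \<kappa>\<close> has a maximum; for odd \<open>m\<close> the cusps of the Wigner caustic are the zeros of \<open>G\<close>.
  Traversing a branch sweeps the angle \<open>2 \<pi> n\<close>, under which \<open>G\<close> and the chord are periodic; for \<open>m = n\<close> it
  sweeps only \<open>\<pi> n\<close>, under which both are antiperiodic. This sign gives the parity of the number of cusps and
  decides between integer and half-integer rotation number, and Rolle's theorem on the circle compares the two
  numbers of cusps.
\<close>

section \<open>Connectedness and continuity\<close>

lemma same_sign_on_connected:
  fixes h :: "'a::topological_space \<Rightarrow> real"
  assumes connected: "connected S" "a \<in> S" "b \<in> S" and cont: "continuous_on S h"
    and nz: "\<And>x. x \<in> S \<Longrightarrow> h x \<noteq> 0"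
  shows "h a > 0 \<longleftrightarrow> h b > 0"
proof (rule ccontr)
  assume "\<not> ?thesis"
  then have "h a \<le> 0 \<and> 0 \<le> h b \<or> h b \<le> 0 \<and> 0 \<le> h a" by linarith
  moreover have "connected (h ` S)" by (rule connected_continuous_image[OF cont connected(1)])
  ultimately have "0 \<in> h ` S"
    using connectedD_interval[of "h ` S"] connected(2,3) by blast
  then show False using nz by force
qed

lemma continuous_on_Ints_constant_on:
  fixes g :: "'a::topological_space \<Rightarrow> 'b::real_normed_algebra_1"
  assumes "connected S" "continuous_on S g" and int: "\<And>x. x \<in> S \<Longrightarrow> g x \<in> \<int>"
  shows "g constant_on S"
proof (rule continuous_discrete_range_constant[OF assms(1,2)])
  fix x assume "x \<in> S"
  have "1 \<le> norm (g y - g x)" if y_neq: "y \<in> S" "g y \<noteq> g x" for y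
  proof -
    obtain i where diff: "g y - g x = of_int i"
      using Ints_diff[OF int[OF y_neq(1)] int[OF \<open>x \<in> S\<close>]] by (elim Ints_cases)
    then have "i \<noteq> 0" using y_neq(2) by auto
    then show ?thesis unfolding diff norm_of_int by linarith
  qed
  then show "\<exists>e>0. \<forall>y. y \<in> S \<and> g y \<noteq> g x \<longrightarrow> e \<le> norm (g y - g x)"
    by (intro exI[of _ 1]) auto
qed

lemma continuous_on_constant_off_finite:
  fixes g :: "'a::metric_space \<Rightarrow> 'b::t1_space"
  assumes connected: "connected S" "x \<in> S" "y \<in> S" "x \<noteq> y" and "continuous_on S g"
    and fin: "finite {z \<in> S. g z \<noteq> c}"
  shows "g x = c"
proof (rule ccontr)
  assume "g x \<noteq> c"
  have "S = {z \<in> S. g z \<noteq> c} \<union> {z \<in> S. g z = c}" by blast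
  moreover have "x islimpt S"
    by (rule connected_imp_perfect[OF connected(1,2)]) (use connected(2-4) in blast)
  ultimately have "x islimpt {z \<in> S. g z = c}"
    using islimpt_Un_finite[OF fin] by metis
  moreover have "closedin (top_of_set S) {z \<in> S. g z = c}"
    by (rule continuous_closedin_preimage_constant[OF assms(5)])
  ultimately show False using connected(2) \<open>g x \<noteq> c\<close> by (auto simp: closedin_limpt)
qed

lemma components_Union_finite_disjoint_closed:
  assumes "finite \<C>" "pairwise disjnt \<C>"
    and pieces: "\<And>C. C \<in> \<C> \<Longrightarrow> closed C \<and> connected C \<and> C \<noteq> {}"
  shows "components (\<Union>\<C>) = \<C>"
proof -
  have comp: "connected_component_set (\<Union>\<C>) x = C" if mem: "C \<in> \<C>" "x \<in> C" for C x
  proof (rule connected_component_unique)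
    fix T assume T_connected: "x \<in> T" "T \<subseteq> \<Union>\<C>" "connected T"
    let ?R = "\<Union>(\<C> - {C})"
    have "closed C" "closed ?R" using pieces mem(1) assms(1) by (auto intro: closed_Union)
    moreover have "C \<inter> ?R = {}"
      using assms(2) mem(1) by (auto simp: pairwise_def disjnt_def)
    ultimately have "T \<inter> ?R = {}"
      using connected_closedD[OF T_connected(3), of C ?R] T_connected(1,2) mem by blast
    then show "T \<subseteq> C" using T_connected(2) by blast
  qed (use mem pieces in auto)
  have "\<C> \<subseteq> components (\<Union>\<C>)"
  proof
    fix C assume "C \<in> \<C>"
    moreover then obtain x where "x \<in> C" using pieces by blast
    ultimately show "C \<in> components (\<Union>\<C>)" using comp unfolding components_iff by blast
  qed
  moreover have "components (\<Union>\<C>) \<subseteq> \<C>" using comp by (auto simp: components_iff)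
  ultimately show ?thesis by blast
qed

section \<open>Periodic functions\<close>

lemma periodic_eq_if_rcong:
  fixes g :: "real \<Rightarrow> 'a"
  assumes "\<And>y. g (y + L) = g y" "[x = y] (rmod L)"
  shows "g x = g y"
proof -
  interpret periodic_fun_simple g L by standard (rule assms(1))
  show ?thesis using assms(2) plus_of_int by (auto simp: rcong_altdef)
qed

lemma plus_of_int_if_plus_1:
  fixes g :: "real \<Rightarrow> real"
  assumes "\<And>t. g (t + 1) = g t + c"
  shows "g (t + of_int j) = g t + of_int j * c"
proof -
  have "g (t + of_int j) - c * (t + of_int j) = g t - c * t"
    by (rule periodic_eq_if_rcong[of "\<lambda>t. g t - c * t" 1])
      (auto simp: assms algebra_simps rcong_altdef intro: exI[of _ "- j"])
  then show ?thesis by (simp add: algebra_simps)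
qed

lemma continuous_periodic_ex_translate_eq:
  fixes H :: "real \<Rightarrow> real"
  assumes cont: "continuous_on UNIV H" and "L > 0" and per: "\<And>y. H (y + L) = H y"
  shows "\<exists>y. H (y + d) = H y"
proof (rule ccontr)
  assume never_equal: "\<nexists>y. H (y + d) = H y"
  obtain z where z_max: "\<And>y. y \<in> {0..L} \<Longrightarrow> H y \<le> H z"
    using continuous_attains_sup[of "{0..L}" H] continuous_on_subset[OF cont] \<open>L > 0\<close>
    by (metis atLeastatMost_empty_iff compact_Icc less_eq_real_def linorder_not_less subset_UNIV)
  have max: "H y \<le> H z" for y
  proof -
    have "H y = H (y rmod L)" by (rule periodic_eq_if_rcong[of H L, OF per]) simp
    also have "\<dots> \<le> H z"
      using rmod_nonneg[of L y] rmod_le[of L y] \<open>L > 0\<close> by (intro z_max) auto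
    finally show ?thesis .
  qed
  have "continuous_on UNIV (\<lambda>y. H (y + d) - H y)"
    by (intro continuous_intros continuous_on_compose2[OF cont]) auto
  then have "H (z - d + d) - H (z - d) > 0 \<longleftrightarrow> H (z + d) - H z > 0"
    using never_equal by (intro same_sign_on_connected[of UNIV]) auto
  moreover have "H (z - d) < H z" "H (z + d) \<le> H z"
    using max never_equal by (metis diff_add_cancel order_le_imp_less_or_eq, blast)
  ultimately show False by simp
qed

definition fundamental_domain :: "real \<Rightarrow> real set \<Rightarrow> bool" where
  "fundamental_domain L S \<longleftrightarrow> (\<forall>y. \<exists>!x. x \<in> S \<and> [x = y] (rmod L))"

lemma fundamental_domain_Ico:
  assumes "L > 0"
  shows "fundamental_domain L {c..<c + L}"
  unfolding fundamental_domain_def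
proof (intro allI ex_ex1I)
  fix y
  have "[c + (y - c) rmod L = c + (y - c)] (rmod L)"
    by (simp only: rcong_add_left_cancel rcong_rmod_left_iff rcong_refl)
  then show "\<exists>x. x \<in> {c..<c + L} \<and> [x = y] (rmod L)"
    using assms rmod_nonneg[of L "y - c"] rmod_less[of L "y - c"]
    by (intro exI[of _ "c + (y - c) rmod L"]) auto
next
  fix x x' y
  assume "x \<in> {c..<c + L} \<and> [x = y] (rmod L)" "x' \<in> {c..<c + L} \<and> [x' = y] (rmod L)"
  then show "x = x'"
    by (intro rcong_imp_eq[of x x' L]) (auto simp: rcong_def)
qed

lemma card_fundamental_domain:
  assumes dom_S: "fundamental_domain L S" and dom_T: "fundamental_domain L T"
    and per: "\<And>y. P (y + L) \<longleftrightarrow> P y"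
  shows "card {y \<in> S. P y} = card {y \<in> T. P y}"
proof -
  define rep where "rep U y = (THE x. x \<in> U \<and> [x = y] (rmod L))" for U y
  have rep: "rep U y \<in> U" "[rep U y = y] (rmod L)" if "fundamental_domain L U" for U y
    using theI'[of "\<lambda>x. x \<in> U \<and> [x = y] (rmod L)"] that
    by (auto simp: fundamental_domain_def rep_def)
  have rep_eq: "rep U x = y" if "fundamental_domain L U" "y \<in> U" "[y = x] (rmod L)" for U x y
    using rep[OF that(1), of x] that by (auto simp: fundamental_domain_def)
  have P_rep: "P (rep U y) \<longleftrightarrow> P y" if "fundamental_domain L U" for U y
    using periodic_eq_if_rcong[of P, OF per rep(2)[OF that]] .
  have "bij_betw (rep T) {y \<in> S. P y} {y \<in> T. P y}"
  proof (rule bij_betw_byWitness[where f' = "rep S"])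
    show "\<forall>y\<in>{y \<in> S. P y}. rep S (rep T y) = y"
      using rep_eq[OF dom_S] rep(2)[OF dom_T] by (auto simp: rcong_sym_iff)
    show "\<forall>y\<in>{y \<in> T. P y}. rep T (rep S y) = y"
      using rep_eq[OF dom_T] rep(2)[OF dom_S] by (auto simp: rcong_sym_iff)
  qed (use rep dom_S dom_T P_rep in auto)
  then show ?thesis by (rule bij_betw_same_card)
qed

lemma simple_loop_winds_once:
  fixes X :: "real \<Rightarrow> real"
  assumes cont: "continuous_on {0..1} X" and "L > 0" and closed: "[X 0 = X 1] (rmod L)" "X 1 \<noteq> X 0"
    and inj: "\<And>u v. u \<in> {0..<1} \<Longrightarrow> v \<in> {0..<1} \<Longrightarrow> [X u = X v] (rmod L) \<Longrightarrow> u = v"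
  shows "\<bar>X 1 - X 0\<bar> = L"
proof -
  obtain j :: int where winding: "X 1 = X 0 + of_int j * L"
    using closed(1) unfolding rcong_altdef by blast
  have "\<bar>j\<bar> = 1"
  proof (rule ccontr)
    assume "\<bar>j\<bar> \<noteq> 1"
    moreover have "j \<noteq> 0" using winding closed(2) by auto
    ultimately consider "j \<ge> 2" | "j \<le> -2" by linarith
    then obtain i :: int where attained: "\<exists>u. 0 \<le> u \<and> u \<le> 1 \<and> X u = X 0 + of_int i * L" "i \<noteq> 0" "i \<noteq> j"
    proof cases
      case 1
      then have "1 * L \<le> of_int j * L" using \<open>L > 0\<close> by (intro mult_right_mono) auto
      then show ?thesis
        using IVT'[of X 0 "X 0 + L" 1] cont winding \<open>L > 0\<close> 1 by (intro that[of 1]) auto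
    next
      case 2
      then have "of_int j * L \<le> -1 * L" using \<open>L > 0\<close> by (intro mult_right_mono) auto
      then show ?thesis
        using IVT2'[of X 1 "X 0 - L" 0] cont winding \<open>L > 0\<close> 2 by (intro that[of "-1"]) auto
    qed
    then obtain u where u_attains: "u \<in> {0..1}" "X u = X 0 + of_int i * L" by auto
    then have "u \<noteq> 0" "u \<noteq> 1" using attained winding \<open>L > 0\<close> by auto
    moreover have "[X 0 = X u] (rmod L)" using u_attains(2) unfolding rcong_altdef by blast
    ultimately show False using inj[of 0 u] u_attains(1) by auto
  qed
  then have "\<bar>real_of_int j\<bar> = 1" by linarith
  then show ?thesis using winding \<open>L > 0\<close> by (simp add: abs_mult)
qed

section \<open>Counting zeros\<close>

locale simple_zeros =
  fixes h h' :: "real \<Rightarrow> real"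
  assumes deriv: "(h has_real_derivative h' x) (at x)"
    and simple: "h x = 0 \<Longrightarrow> h' x \<noteq> 0"
begin

lemma continuous: "continuous_on S h"
  using deriv by (meson DERIV_isCont continuous_at_imp_continuous_on)

lemma not_islimpt_zeros: "\<not> l islimpt {x. h x = 0}"
proof -
  have "\<forall>\<^sub>F x in at l. h x \<noteq> 0"
  proof (cases "h l = 0")
    case True
    have "((\<lambda>x. (h x - h l) / (x - l)) \<longlongrightarrow> h' l) (at l)"
      using deriv[of l] by (simp add: has_field_derivative_iff)
    then have "\<forall>\<^sub>F x in at l. (h x - h l) / (x - l) \<noteq> 0"
      using simple[OF True] by (rule tendsto_imp_eventually_ne)
    then show ?thesis by eventually_elim (auto simp: True)
  next
    case False
    then show ?thesis
      using DERIV_isCont[OF deriv, of l] by (auto simp: isCont_def intro: tendsto_imp_eventually_ne)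
  qed
  then show ?thesis by (simp add: islimpt_iff_eventually)
qed

lemma finite_zeros:
  assumes "compact S"
  shows "finite {x \<in> S. h x = 0}"
  using finite_not_islimpt_in_compact[OF assms not_islimpt_zeros] by (simp add: Collect_conj_eq)

lemma sign_change_at_only_zero:
  assumes zero_at: "a < z" "z < b" "h z = 0" and only: "\<And>x. x \<in> {a..b} \<Longrightarrow> h x = 0 \<Longrightarrow> x = z"
  shows "h a > 0 \<longleftrightarrow> \<not> h b > 0"
proof -
  let ?c = "h' z"
  have slope_sq_pos: "?c * ?c > 0" 
    using simple[OF zero_at(3)] by (auto simp: zero_less_mult_iff linorder_neq_iff)
  have "((\<lambda>x. ?c * h x) has_real_derivative ?c * ?c) (at z)" by (rule DERIV_cmult[OF deriv])
  from DERIV_pos_inc_right[OF this slope_sq_pos] DERIV_pos_inc_left[OF this slope_sq_pos] obtain d d'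
    where right: "d > 0" "\<And>e. 0 < e \<Longrightarrow> e < d \<Longrightarrow> ?c * h (z + e) > 0"
      and left: "d' > 0" "\<And>e. 0 < e \<Longrightarrow> e < d' \<Longrightarrow> ?c * h (z - e) < 0"
    using zero_at(3) by auto
  obtain e where "0 < e" "e < min (min d d') (min (z - a) (b - z))"
    using right left zero_at dense[of 0 "min (min d d') (min (z - a) (b - z))"] by auto
  then have e_small: "0 < e" "e < d" "e < d'" "e < z - a" "e < b - z" by auto
  have "h (z - e) > 0 \<longleftrightarrow> \<not> h (z + e) > 0"
    using right(2)[of e] left(2)[of e] e_small by (auto simp: zero_less_mult_iff mult_less_0_iff)
  moreover have "h a > 0 \<longleftrightarrow> h (z - e) > 0"
  proof (rule same_sign_on_connected[OF _ _ _ continuous])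
    show "h x \<noteq> 0" if "x \<in> {a..z - e}" for x using only[of x] that e_small by auto
  qed (use e_small in auto)
  moreover have "h (z + e) > 0 \<longleftrightarrow> h b > 0"
  proof (rule same_sign_on_connected[OF _ _ _ continuous])
    show "h x \<noteq> 0" if "x \<in> {z + e..b}" for x using only[of x] that e_small zero_at by auto
  qed (use e_small in auto)
  ultimately show ?thesis by blast
qed

lemma even_card_zeros_iff:
  assumes "a \<le> b" "h a \<noteq> 0" "h b \<noteq> 0"
  shows "even (card {x \<in> {a..b}. h x = 0}) \<longleftrightarrow> (h a > 0 \<longleftrightarrow> h b > 0)"
  using assms
proof (induction "card {x \<in> {a..b}. h x = 0}" arbitrary: a rule: less_induct)
  case less
  let ?Z = "\<lambda>a. {x \<in> {a..b}. h x = 0}"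
  have fin: "finite (?Z a)" for a by (rule finite_zeros[OF compact_Icc])
  show ?case
  proof (cases "?Z a = {}")
    case True
    then have "h a > 0 \<longleftrightarrow> h b > 0"
      using less.prems by (intro same_sign_on_connected[of "{a..b}"] continuous) auto
    then show ?thesis unfolding True by simp
  next
    case False
    define z where "z = Min (?Z a)"
    have "z \<in> ?Z a" and first: "\<And>x. x \<in> ?Z a \<Longrightarrow> z \<le> x"
      using Min_in[OF fin False] Min_le[OF fin] by (auto simp: z_def)
    then have zero_at: "a < z" "z < b" "h z = 0" using less.prems by (auto simp: less_le)
    obtain d where isolated: "d > 0" "\<And>x. x \<in> ?Z a \<Longrightarrow> x \<noteq> z \<Longrightarrow> d \<le> dist z x"
      using finite_set_avoid[OF fin] by blast
    obtain c where c_between: "z < c" "c < min (z + d) b"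
      using dense[of z "min (z + d) b"] isolated(1) zero_at by auto
    have gap: "x = z" if "x \<in> {a..c}" "h x = 0" for x
      using first[of x] isolated(2)[of x] c_between that by (auto simp: dist_real_def)
    have "?Z a = insert z (?Z c)" using gap c_between zero_at by force
    then have card: "card (?Z a) = Suc (card (?Z c))"
      using c_between fin[of c] by (subst \<open>?Z a = _\<close>, subst card_insert_disjoint) auto
    have c_nz: "h c \<noteq> 0" using gap[of c] c_between zero_at by auto
    have "even (card (?Z a)) \<longleftrightarrow> \<not> (h c > 0 \<longleftrightarrow> h b > 0)"
      using less.hyps[of c] c_between c_nz less.prems(3) unfolding card by auto
    also have "\<dots> \<longleftrightarrow> (h a > 0 \<longleftrightarrow> h b > 0)"
      using sign_change_at_only_zero[OF zero_at(1) c_between(1) zero_at(3) gap] by blast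
    finally show ?thesis .
  qed
qed

lemma even_card_zeros_quasiperiodic_iff:
  assumes "L > 0" and quasi: "\<And>y. h (y + L) = \<sigma> * h y" and sign: "\<sigma> = 1 \<or> \<sigma> = -1"
    and dom: "fundamental_domain L S"
  shows "even (card {y \<in> S. h y = 0}) \<longleftrightarrow> \<sigma> = 1"
proof -
  have "infinite {0..1::real}" by simp
  then have "{x \<in> {0..1}. h x = 0} \<noteq> {0..1}"
    using finite_zeros[OF compact_Icc[of 0 1]] by metis
  then obtain d where d_nz: "h d \<noteq> 0" by blast
  have "card {y \<in> S. h y = 0} = card {y \<in> {d..<d + L}. h y = 0}"
    using quasi sign by (intro card_fundamental_domain[OF dom fundamental_domain_Ico] \<open>L > 0\<close>) auto
  also have "{y \<in> {d..<d + L}. h y = 0} = {y \<in> {d..d + L}. h y = 0}"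
    using d_nz quasi sign by (auto simp: less_le)
  finally show ?thesis
    using even_card_zeros_iff[of d "d + L"] d_nz quasi[of d] sign \<open>L > 0\<close> by auto
qed

end

lemma Rolle_card_zeros:
  fixes g g' :: "real \<Rightarrow> real"
  assumes deriv: "\<And>x. (g has_real_derivative g' x) (at x)"
    and fin: "finite {x \<in> {a..b}. g' x = 0}"
    and "finite Z" "Z \<subseteq> {a..b}" "\<And>z. z \<in> Z \<Longrightarrow> g z = 0"
  shows "card Z \<le> Suc (card {x \<in> {a<..<b}. g' x = 0})"
  using assms(3-5) fin
proof (induction Z arbitrary: b rule: finite_linorder_max_induct)
  case (insert z A)
  show ?case
  proof (cases "A = {}")
    case False
    define y where "y = Max A"
    have last: "y \<in> A" "y < z" "A \<subseteq> {a..y}" "a \<le> y" "z \<le> b"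
      using insert Max_in[OF insert.hyps(1) False] Max_ge[OF insert.hyps(1)] by (auto simp: y_def)
    let ?C = "\<lambda>b. {x \<in> {a<..<b}. g' x = 0}"
    have fin: "finite (?C b)" by (rule finite_subset[OF _ insert.prems(3)]) auto
    have "g y = g z" using insert.prems(2) last(1) by auto
    moreover have "continuous_on {y..z} g"
      using deriv by (meson DERIV_isCont continuous_at_imp_continuous_on)
    moreover have "g differentiable (at x)" for x
      using deriv real_differentiable_def by blast
    ultimately obtain x where "y < x" "x < z" "(g has_real_derivative 0) (at x)"
      using Rolle[OF last(2), of g] by blast
    then have crit: "y < x" "x < z" "g' x = 0" using DERIV_unique[OF deriv] by blast+
    have "card A \<le> Suc (card (?C y))"
      using last insert.prems by (intro insert.IH finite_subset[OF _ insert.prems(3)]) auto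
    also have "Suc (card (?C y)) = card (insert x (?C y))"
      using crit last by (subst card_insert_disjoint) (auto intro: finite_subset[OF _ fin])
    also have "\<dots> \<le> card (?C b)"
      using crit last by (intro card_mono[OF fin]) auto
    finally show ?thesis using insert.hyps by (simp add: card_insert_if)
  qed simp
qed simp

lemma card_zeros_le_card_deriv_zeros_periodic:
  fixes g g' :: "real \<Rightarrow> real"
  assumes deriv: "\<And>x. (g has_real_derivative g' x) (at x)"
    and fin: "\<And>a b. finite {x \<in> {a..b}. g' x = 0}"
    and "L > 0" and per: "\<And>y. g (y + L) = 0 \<longleftrightarrow> g y = 0" "\<And>y. g' (y + L) = 0 \<longleftrightarrow> g' y = 0"
    and dom: "fundamental_domain L S"
  shows "card {y \<in> S. g y = 0} \<le> card {y \<in> S. g' y = 0}"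
proof (cases "\<exists>z. g z = 0")
  case True
  then obtain z where z_zero: "g z = 0" by blast
  let ?I = "{z..<z + L}"
  note card_I = card_fundamental_domain[OF dom fundamental_domain_Ico[OF \<open>L > 0\<close>, of z]]
  have "card {y \<in> ?I. g y = 0} \<le> card {y \<in> ?I. g' y = 0}"
  proof (cases "finite {y \<in> ?I. g y = 0}")
    case True
    have "Suc (card {y \<in> ?I. g y = 0}) = card (insert (z + L) {y \<in> ?I. g y = 0})"
      using True by simp
    also have "\<dots> \<le> Suc (card {y \<in> {z<..<z + L}. g' y = 0})"
      using True z_zero per(1) \<open>L > 0\<close> by (intro Rolle_card_zeros[OF deriv fin]) auto
    also have "card {y \<in> {z<..<z + L}. g' y = 0} \<le> card {y \<in> ?I. g' y = 0}"
      by (intro card_mono finite_subset[OF _ fin[of z "z + L"]]) auto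
    finally show ?thesis by simp
  qed simp
  then show ?thesis using card_I[of "\<lambda>y. g y = 0"] card_I[of "\<lambda>y. g' y = 0"] per by simp
qed simp

section \<open>Curves in the plane\<close>

lemma orthogonal_angle_exists:
  fixes E :: "'a::real_normed_vector \<Rightarrow> complex"
  assumes "continuous_on S E" "contractible S" "\<And>u. u \<in> S \<Longrightarrow> E u \<noteq> 0"
  obtains \<phi> where "continuous_on S \<phi>" "\<And>u. u \<in> S \<Longrightarrow> Re (cnj (cis (\<phi> u)) * E u) = 0"
proof -
  obtain g where log_E: "continuous_on S g" "\<And>u. u \<in> S \<Longrightarrow> E u = exp (g u)"
    using continuous_logarithm_on_contractible[OF assms] by blast
  show ?thesis
  proof (rule that[of "\<lambda>u. Im (g u) + pi / 2"])
    show "continuous_on S (\<lambda>u. Im (g u) + pi / 2)" by (intro continuous_intros log_E(1))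
    show "Re (cnj (cis (Im (g u) + pi / 2)) * E u) = 0" if "u \<in> S" for u
      by (simp add: log_E(2)[OF that] Re_exp Im_exp cos_add sin_add)
  qed
qed

lemma orthogonal_angle_turn:
  fixes E :: "'a::topological_space \<Rightarrow> complex"
  assumes connected: "connected S" "a \<in> S" "b \<in> S" and E_props: "continuous_on S E" "\<And>u. u \<in> S \<Longrightarrow> E u \<noteq> 0"
    and orthogonal: "continuous_on S \<phi>" "\<And>u. u \<in> S \<Longrightarrow> Re (cnj (cis (\<phi> u)) * E u) = 0"
    and ends: "E b = of_real \<sigma> * E a" "\<bar>\<sigma>\<bar> = 1"
  shows "cis (\<phi> b - \<phi> a) = of_real \<sigma>"
proof -
  define \<rho> where "\<rho> u = Im (cnj (cis (\<phi> u)) * E u)" for u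
  have E_eq: "E u = cis (\<phi> u) * (\<i> * of_real (\<rho> u))" if "u \<in> S" for u
  proof -
    have "cnj (cis (\<phi> u)) * E u = \<i> * of_real (\<rho> u)"
      using orthogonal(2)[OF that] by (simp add: \<rho>_def complex_eq_iff)
    moreover have "E u = cis (\<phi> u) * (cnj (cis (\<phi> u)) * E u)" by (simp add: cis_cnj cis_mult flip: mult.assoc)
    ultimately show ?thesis by simp
  qed
  have \<rho>_nz: "\<rho> u \<noteq> 0" if "u \<in> S" for u using E_eq[OF that] E_props(2)[OF that] by auto
  have "continuous_on S \<rho>" unfolding \<rho>_def by (intro continuous_intros orthogonal E_props)
  then have "\<rho> a > 0 \<longleftrightarrow> \<rho> b > 0" by (rule same_sign_on_connected[OF connected _ \<rho>_nz])
  moreover have "\<bar>\<rho> b\<bar> = \<bar>\<rho> a\<bar>"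
    using arg_cong[OF ends(1), of cmod] ends(2) E_eq connected by (simp add: norm_mult)
  ultimately have "\<rho> b = \<rho> a" by linarith
  then have "cis (\<phi> b) = of_real \<sigma> * cis (\<phi> a)"
    using ends(1) E_eq[OF connected(2)] E_eq[OF connected(3)] \<rho>_nz[OF connected(2)] by simp
  then show ?thesis by (simp flip: cis_divide)
qed

lemma has_vector_derivative_weighted_mean:
  fixes p q :: "real \<Rightarrow> real" and A B :: "real \<Rightarrow> 'a::real_normed_vector"
  assumes p_deriv: "(p has_real_derivative p') (at x)" and q_deriv: "(q has_real_derivative q') (at x)"
    and A_deriv: "(A has_vector_derivative A') (at x)" and B_deriv: "(B has_vector_derivative B') (at x)"
    and nz: "p x + q x \<noteq> 0"
  shows "((\<lambda>t. (p t *\<^sub>R A t + q t *\<^sub>R B t) /\<^sub>R (p t + q t)) has_vector_derivative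
    (p x *\<^sub>R A' + q x *\<^sub>R B') /\<^sub>R (p x + q x)
      + ((p' * q x - p x * q') / (p x + q x)\<^sup>2) *\<^sub>R (A x - B x)) (at x)"
proof -
  have "((\<lambda>t. inverse (p t + q t)) has_real_derivative - ((p' + q') / (p x + q x)\<^sup>2)) (at x)"
    using DERIV_inverse_fun[OF DERIV_add[OF p_deriv q_deriv] nz] by (simp add: power2_eq_square divide_inverse)
  note product_rule = has_vector_derivative_scaleR[OF this
      has_vector_derivative_add[OF has_vector_derivative_scaleR[OF p_deriv A_deriv]
        has_vector_derivative_scaleR[OF q_deriv B_deriv]]]
  have "p' / (p x + q x) - (p' + q') / (p x + q x)\<^sup>2 * p x = (p' * q x - p x * q') / (p x + q x)\<^sup>2"
    "q' / (p x + q x) - (p' + q') / (p x + q x)\<^sup>2 * q x = - ((p' * q x - p x * q') / (p x + q x)\<^sup>2)"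
    using nz by (simp_all add: divide_simps) (simp_all add: algebra_simps power2_eq_square)
  then have "((p' * q x - p x * q') / (p x + q x)\<^sup>2) *\<^sub>R (A x - B x)
    = (p' / (p x + q x) - (p' + q') / (p x + q x)\<^sup>2 * p x) *\<^sub>R A x
      + (q' / (p x + q x) - (p' + q') / (p x + q x)\<^sup>2 * q x) *\<^sub>R B x"
    by (simp only: scaleR_diff_right scaleR_minus_left) simp
  then show ?thesis
    by (intro has_vector_derivative_eq_rhs[OF product_rule]) (simp only:, simp add: algebra_simps divide_inverse)
qed

lemma D_eqI: "(g has_vector_derivative g') (at t) \<Longrightarrow> D g t = g'"
  by (simp add: D_def vector_derivative_at)

lemma has_D_if_differentiable:
  "g differentiable (at t) \<Longrightarrow> (g has_vector_derivative D g t) (at t)"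
  by (simp add: D_def vector_derivative_works)

lemma D_plus_period:
  assumes "\<And>t. g (t + p) = g t"
  shows "D g (t + p) = D g t"
proof -
  have shift: "((\<lambda>t. g (t + c)) has_vector_derivative d) (at t)"
    if "(g has_vector_derivative d) (at (t + c))" for t c d
  proof -
    have "((\<lambda>t. t + c) has_vector_derivative 1) (at t)" by (auto intro!: derivative_eq_intros)
    from vector_diff_chain_at[OF this that] show ?thesis by (simp add: o_def)
  qed
  have "g (t - p) = g t" for t using assms[of "t - p"] by simp
  then have "(g has_vector_derivative d) (at (t + p)) \<longleftrightarrow> (g has_vector_derivative d) (at t)" for d
    using shift[of d t p] shift[of d "t + p" "- p"] assms by auto
  then show ?thesis by (simp add: D_def vector_derivative_def)
qed

lemma smooth_fun_has_D: "smooth_fun g \<Longrightarrow> (g has_vector_derivative D g t) (at t)"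
  unfolding smooth_fun_def by (drule spec[of _ 0]) simp

lemma smooth_fun_D: "smooth_fun g \<Longrightarrow> smooth_fun (D g)"
  unfolding smooth_fun_def by (metis comp_apply funpow_Suc_right)

lemma has_real_derivative_cmod:
  assumes "(g has_vector_derivative g') (at t)" "g t \<noteq> 0"
  shows "((\<lambda>t. cmod (g t)) has_real_derivative Re (cnj (g t) * g') / cmod (g t)) (at t)"
proof -
  have "((\<lambda>t. cmod (g t)) has_derivative (\<lambda>h. (h *\<^sub>R g') \<bullet> sgn (g t))) (at t)"
    using has_derivative_compose[OF assms(1)[unfolded has_vector_derivative_def]
        has_derivative_norm[OF assms(2)]] .
  moreover have "(\<lambda>h. (h *\<^sub>R g') \<bullet> sgn (g t)) = (*) (Re (cnj (g t) * g') / cmod (g t))"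
    by (simp add: fun_eq_iff inner_complex_def sgn_div_norm field_simps add_divide_distrib)
  ultimately show ?thesis by (simp add: has_field_derivative_def)
qed

lemma has_real_derivative_cross:
  assumes "(u has_vector_derivative u') (at t)" "(v has_vector_derivative v') (at t)"
  shows "((\<lambda>t. Im (cnj (u t) * v t)) has_real_derivative Im (cnj u' * v t) + Im (cnj (u t) * v')) (at t)"
    and "((\<lambda>t. Re (cnj (u t) * v t)) has_real_derivative Re (cnj u' * v t) + Re (cnj (u t) * v')) (at t)"
proof -
  have "((\<lambda>t. cnj (u t) * v t) has_vector_derivative cnj (u t) * v' + cnj u' * v t) (at t)"
    by (intro has_vector_derivative_mult has_vector_derivative_cnj assms)
  then show "((\<lambda>t. Im (cnj (u t) * v t)) has_real_derivative Im (cnj u' * v t) + Im (cnj (u t) * v')) (at t)"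
    "((\<lambda>t. Re (cnj (u t) * v t)) has_real_derivative Re (cnj u' * v t) + Re (cnj (u t) * v')) (at t)"
    unfolding has_real_derivative_iff_has_vector_derivative
    using bounded_linear.has_vector_derivative[OF bounded_linear_Im]
      bounded_linear.has_vector_derivative[OF bounded_linear_Re] by (fastforce simp: add.commute)+
qed

lemma curv_has_derivative:
  assumes smooth: "smooth_fun f" and nz: "D f t \<noteq> 0"
  shows "(curv f has_real_derivative Im (cnj (D f t) * D (D (D f)) t) / cmod (D f t) ^ 3
    - 3 * Im (cnj (D f t) * D (D f) t) * Re (cnj (D f t) * D (D f) t) / cmod (D f t) ^ 5) (at t)"
proof -
  note D_deriv = smooth_fun_has_D[OF smooth_fun_D[OF smooth]]
    and D2_deriv = smooth_fun_has_D[OF smooth_fun_D[OF smooth_fun_D[OF smooth]]]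
  show ?thesis
    unfolding curv_def[abs_def]
    by (rule derivative_eq_intros has_real_derivative_cross[OF D_deriv D2_deriv]
          has_real_derivative_cmod[OF D_deriv nz] refl)+
      (use nz in \<open>auto simp: field_simps power_numeral_reduce\<close>)
qed

lemma curv_differentiable:
  assumes smooth: "smooth_fun f" and reg: "\<And>t. D f t \<noteq> 0"
  shows "curv f differentiable (at t)" and "curv1 f differentiable (at t)"
proof -
  let ?v = "\<lambda>t. cmod (D f t)" and ?c2 = "\<lambda>t. Im (cnj (D f t) * D (D f) t)"
    and ?r2 = "\<lambda>t. Re (cnj (D f t) * D (D f) t)" and ?c3 = "\<lambda>t. Im (cnj (D f t) * D (D (D f)) t)"
  note D_deriv = smooth_fun_has_D[OF smooth_fun_D[OF smooth]]
    and D2_deriv = smooth_fun_has_D[OF smooth_fun_D[OF smooth_fun_D[OF smooth]]]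
    and D3_deriv = smooth_fun_has_D[OF smooth_fun_D[OF smooth_fun_D[OF smooth_fun_D[OF smooth]]]]
  have diff: "?v differentiable (at t)" "?c2 differentiable (at t)"
    "?r2 differentiable (at t)" "?c3 differentiable (at t)"
    using has_real_derivative_cmod[OF D_deriv reg] has_real_derivative_cross[OF D_deriv D2_deriv]
      has_real_derivative_cross[OF D_deriv D3_deriv]
      real_differentiable_def by blast+
  have "D (curv f) = (\<lambda>t. ?c3 t / ?v t ^ 3 - 3 * ?c2 t * ?r2 t / ?v t ^ 5)"
    using curv_has_derivative[OF smooth reg]
    by (intro ext D_eqI) (simp only: has_real_derivative_iff_has_vector_derivative)
  then have "curv1 f = (\<lambda>t. (?c3 t / ?v t ^ 3 - 3 * ?c2 t * ?r2 t / ?v t ^ 5) / ?v t)"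
    by (simp only: curv1_def arcD_def fun_eq_iff) simp
  moreover have "?v t \<noteq> 0" using reg by simp
  ultimately show "curv1 f differentiable (at t)"
    by (simp only:) (intro derivative_intros diff, auto)
  show "curv f differentiable (at t)"
    using curv_has_derivative[OF smooth reg] real_differentiable_def by blast
qed

section \<open>The tangent angle of a rosette\<close>

lemma exp_lift_exists:
  fixes g g' :: "real \<Rightarrow> complex"
  assumes deriv: "\<And>t. (g has_vector_derivative g' t) (at t)" and cont: "\<And>t. isCont g' t" and nz: "\<And>t. g t \<noteq> 0"
  obtains L where "\<And>t. (L has_vector_derivative g' t / g t) (at t)" "\<And>t. g t = exp (L t)"
proof -
  have "isCont g t" for t by (rule has_vector_derivative_continuous[OF deriv])
  then have "\<exists>F. \<forall>x::real. -\<infinity> < ereal x \<longrightarrow> ereal x < \<infinity> \<longrightarrow> (F has_vector_derivative g' x / g x) (at x)"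
    by (intro einterval_antiderivative) (auto intro!: continuous_intros cont nz)
  then obtain F where antideriv: "\<And>t. (F has_vector_derivative g' t / g t) (at t)" by auto
  define L where "L t = F t - F 0 + Ln (g 0)" for t
  have L_deriv: "(L has_vector_derivative g' t / g t) (at t)" for t
    unfolding L_def by (auto intro!: derivative_eq_intros antideriv)
  have "((\<lambda>t. g t * exp (- L t)) has_vector_derivative 0) (at t)" for t
  proof -
    have "((\<lambda>t. - L t) has_vector_derivative - (g' t / g t)) (at t)"
      by (intro has_vector_derivative_minus L_deriv)
    from has_vector_derivative_mult[OF deriv field_vector_diff_chain_at[OF this DERIV_exp]]
    show ?thesis by (simp add: o_def nz)
  qed
  then obtain c where const: "\<And>t. g t * exp (- L t) = c"
    using has_vector_derivative_zero_constant[of UNIV "\<lambda>t. g t * exp (- L t)"] by auto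
  moreover have "g 0 * exp (- L 0) = 1" using nz by (simp add: L_def exp_minus)
  ultimately have "g t * exp (- L t) = 1" for t by metis
  then have "g t = exp (L t)" for t by (simp add: exp_minus field_simps)
  with L_deriv show ?thesis by (rule that)
qed

lemma exp_lift_plus_period:
  fixes g L :: "real \<Rightarrow> complex"
  assumes cont: "continuous_on UNIV L" and exp: "\<And>t. g t = exp (L t)" and per: "\<And>t. g (t + 1) = g t"
  shows "L (t + 1) = L t + 2 * pi * \<i> * winding_number g 0"
proof -
  have "(\<lambda>t. (L (t + 1) - L t) / (2 * pi * \<i>)) constant_on UNIV"
  proof (rule continuous_on_Ints_constant_on)
    show "continuous_on UNIV (\<lambda>t. (L (t + 1) - L t) / (2 * pi * \<i>))"
      by (intro continuous_intros continuous_on_compose2[OF cont]) auto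
    show "(L (t + 1) - L t) / (2 * pi * \<i>) \<in> \<int>" for t
    proof -
      have "exp (L (t + 1)) = exp (L t)" using per exp by metis
      then obtain j :: int where "L (t + 1) = L t + of_int (2 * j) * pi * \<i>" unfolding exp_eq by blast
      then show ?thesis by (simp add: field_simps)
    qed
  qed simp
  then have "(L (t + 1) - L t) / (2 * pi * \<i>) = (L (0 + 1) - L 0) / (2 * pi * \<i>)"
    unfolding constant_on_def by (metis UNIV_I)
  then have "L (t + 1) = L t + (L 1 - L 0)" by (simp add: diff_eq_eq add.commute)
  moreover have "winding_number g 0 = (L 1 - L 0) / (2 * pi * \<i>)"
  proof -
    have "path L" unfolding path_def by (rule continuous_on_subset[OF cont]) simp
    moreover have "g = exp \<circ> L" using exp by (simp add: fun_eq_iff)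
    ultimately show ?thesis
      using winding_number_compose_exp[of L] by (simp add: pathfinish_def pathstart_def)
  qed
  ultimately show ?thesis by simp
qed

definition turning_rate :: "(real \<Rightarrow> complex) \<Rightarrow> real \<Rightarrow> real" where
  "turning_rate f t = curv f t * cmod (D f t)"

lemma tangent_angle_exists:
  assumes "rosette f n"
  obtains \<theta> where "\<And>t. (\<theta> has_real_derivative turning_rate f t) (at t)"
    "\<And>t. D f t = of_real (cmod (D f t)) * cis (\<theta> t)"
    "\<And>t. \<theta> (t + 1) = \<theta> t + 2 * pi * n"
proof -
  have smooth: "smooth_fun (D f)" and per: "\<And>t. f (t + 1) = f t" and reg: "\<And>t. D f t \<noteq> 0"
    and winding: "winding_number (D f) 0 = of_nat n"
    using assms smooth_fun_D by (auto simp: rosette_def)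
  obtain L where L_deriv: "\<And>t. (L has_vector_derivative D (D f) t / D f t) (at t)"
    and exp: "\<And>t. D f t = exp (L t)"
    by (rule exp_lift_exists[OF smooth_fun_has_D[OF smooth]
          has_vector_derivative_continuous[OF smooth_fun_has_D[OF smooth_fun_D[OF smooth]]] reg]) blast
  have "continuous_on UNIV L"
    by (intro continuous_at_imp_continuous_on ballI has_vector_derivative_continuous[OF L_deriv])
  from exp_lift_plus_period[OF this exp D_plus_period[of f 1, OF per]]
  have L_shift: "L (t + 1) = L t + 2 * pi * \<i> * of_nat n" for t unfolding winding .
  show ?thesis
  proof (rule that[of "\<lambda>t. Im (L t)"])
    show "((\<lambda>t. Im (L t)) has_real_derivative turning_rate f t) (at t)" for t
    proof -
      have "Im (D (D f) t / D f t) = turning_rate f t"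
        unfolding turning_rate_def curv_def complex_div_cnj[of "D (D f) t"] using reg[of t]
        by (simp add: Im_divide_of_real power2_eq_square power3_eq_cube field_simps flip: of_real_power)
      then show ?thesis
        using bounded_linear.has_vector_derivative[OF bounded_linear_Im L_deriv[of t]]
        by (simp add: has_real_derivative_iff_has_vector_derivative)
    qed
    show "D f t = of_real (cmod (D f t)) * cis (Im (L t))" for t
      unfolding exp by (simp add: exp_eq_polar norm_mult)
    show "Im (L (t + 1)) = Im (L t) + 2 * pi * n" for t by (simp add: L_shift)
  qed
qed

lemma
  assumes "rosette f n"
  shows rosette_rotation_number_pos: "n > 0" and rosette_curv_pos: "curv f t > 0"
proof -
  obtain \<theta> where deriv: "\<And>t. (\<theta> has_real_derivative turning_rate f t) (at t)"
    and per: "\<And>t. \<theta> (t + 1) = \<theta> t + 2 * pi * n"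
    using tangent_angle_exists[OF assms] by metis
  have smooth: "smooth_fun f" and reg: "\<And>t. D f t \<noteq> 0" and nz: "\<And>t. curv f t \<noteq> 0"
    using assms by (auto simp: rosette_def)
  obtain z where "\<theta> 1 - \<theta> 0 = turning_rate f z"
    using MVT2[of 0 1 \<theta> "turning_rate f"] deriv by auto
  then have turning: "2 * pi * n = turning_rate f z" using per[of 0] by simp
  moreover have "2 * pi * n \<ge> 0" by simp
  ultimately have "turning_rate f z \<ge> 0" by simp
  then have "curv f z > 0" using reg[of z] nz[of z] by (simp add: turning_rate_def zero_le_mult_iff less_le)
  then show "n > 0" using turning reg[of z] by (cases n) (auto simp: turning_rate_def)
  have "continuous_on UNIV (curv f)"
    using curv_differentiable(1)[OF smooth reg]
    by (intro continuous_at_imp_continuous_on) (simp add: differentiable_imp_continuous_within)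
  then show "curv f t > 0"
    using same_sign_on_connected[of UNIV z t "curv f"] nz \<open>curv f z > 0\<close> by simp
qed

locale rosette_angle =
  fixes f :: "real \<Rightarrow> complex" and n :: nat and \<theta> \<tau> :: "real \<Rightarrow> real"
  assumes rosette: "rosette f n"
    and theta_deriv: "(\<theta> has_real_derivative turning_rate f t) (at t)"
    and D_polar: "D f t = of_real (cmod (D f t)) * cis (\<theta> t)"
    and theta_plus_1: "\<theta> (t + 1) = \<theta> t + 2 * pi * n"
    and tau_theta [simp]: "\<tau> (\<theta> t) = t"
    and theta_tau [simp]: "\<theta> (\<tau> x) = x"

lemma rosette_angle_exists:
  assumes "rosette f n"
  obtains \<theta> \<tau> where "rosette_angle f n \<theta> \<tau>"
proof -
  obtain \<theta> where deriv: "\<And>t. (\<theta> has_real_derivative turning_rate f t) (at t)"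
    and polar: "\<And>t. D f t = of_real (cmod (D f t)) * cis (\<theta> t)"
    and shift: "\<And>t. \<theta> (t + 1) = \<theta> t + 2 * pi * n"
    using tangent_angle_exists[OF assms] by metis
  have "turning_rate f t > 0" for t
    using rosette_curv_pos[OF assms] assms by (simp add: turning_rate_def rosette_def)
  then have "\<theta> s < \<theta> t" if "s < t" for s t
    using that deriv by (meson DERIV_pos_imp_increasing)
  then have "inj \<theta>" by (metis injI less_irrefl linorder_neqE_linordered_idom)
  have "x \<in> range \<theta>" for x
  proof -
    let ?L = "2 * pi * n" and ?y = "\<theta> 0 + (x - \<theta> 0) rmod (2 * pi * n)"
    have "?L > 0" "?L \<noteq> 0" using rosette_rotation_number_pos[OF assms] by simp_all
    then have "\<theta> 0 \<le> ?y" "?y \<le> \<theta> 1"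
      using rmod_nonneg[of ?L "x - \<theta> 0"] rmod_le[of ?L "x - \<theta> 0"] shift[of 0] by auto
    moreover have "continuous_on {0..1} \<theta>"
      using deriv by (meson DERIV_isCont continuous_at_imp_continuous_on)
    ultimately obtain t where theta_t: "\<theta> t = ?y" using IVT'[of \<theta> 0 ?y 1] by auto
    have "[?y = \<theta> 0 + (x - \<theta> 0)] (rmod ?L)"
      by (simp only: rcong_add_left_cancel rcong_rmod_left_iff rcong_refl)
    then obtain j :: int where "x = ?y + of_int j * ?L" by (auto simp: rcong_altdef)
    then have "x = \<theta> (t + of_int j)" using plus_of_int_if_plus_1[of \<theta>, OF shift] theta_t by simp
    then show ?thesis by simp
  qed
  then have "surj \<theta>" by blast
  with \<open>inj \<theta>\<close> have "rosette_angle f n \<theta> (inv \<theta>)"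
    using assms deriv polar shift by unfold_locales (auto simp: surj_f_inv_f)
  then show ?thesis by (rule that)
qed

context rosette_angle
begin

lemma
  shows smooth: "smooth_fun f" and periodic: "f (t + 1) = f t" and D_nz: "D f t \<noteq> 0"
    and curv_pos: "curv f t > 0" and n_pos: "n > 0"
  using rosette rosette_curv_pos[OF rosette] rosette_rotation_number_pos[OF rosette] by (auto simp: rosette_def)

lemma turning_rate_pos: "turning_rate f t > 0"
  by (simp add: turning_rate_def curv_pos D_nz)

lemma tau_deriv: "(\<tau> has_real_derivative 1 / turning_rate f (\<tau> x)) (at x)"
proof -
  have "isCont \<tau> (\<theta> (\<tau> x))"
    by (rule isCont_inverse_function[of 1]) (auto intro: DERIV_isCont[OF theta_deriv])
  then have "(\<tau> has_real_derivative inverse (turning_rate f (\<tau> x))) (at x)"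
    using turning_rate_pos[of "\<tau> x"]
    by (intro DERIV_inverse_function[where f = \<theta> and a = "x - 1" and b = "x + 1"] theta_deriv) auto
  then show ?thesis by (simp add: inverse_eq_divide)
qed

lemma continuous_tau: "continuous_on S \<tau>"
  using tau_deriv by (meson DERIV_isCont continuous_at_imp_continuous_on)

lemma tau_plus_turn: "\<tau> (x + 2 * pi * n) = \<tau> x + 1"
  by (metis tau_theta theta_plus_1 theta_tau)

subsection \<open>Curvature as a function of the angle\<close>

definition \<kappa> :: "real \<Rightarrow> real" where "\<kappa> x = curv f (\<tau> x)"
definition point :: "real \<Rightarrow> complex" where "point x = f (\<tau> x)"
definition log_curv :: "real \<Rightarrow> real" where "log_curv x = ln (\<kappa> x)"

text \<open>Since \<open>\<theta>\<close> has derivative \<open>\<kappa>\<close> with respect to arc length, an angle derivative is an arc-length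
  derivative divided by \<open>\<kappa>\<close>.\<close>

definition log_curv' :: "real \<Rightarrow> real" where
  "log_curv' x = curv1 f (\<tau> x) / \<kappa> x ^ 2"
definition log_curv'' :: "real \<Rightarrow> real" where
  "log_curv'' x = curv2 f (\<tau> x) / \<kappa> x ^ 3 - 2 * (log_curv' x)\<^sup>2"

lemma kappa_pos: "\<kappa> x > 0"
  by (simp add: \<kappa>_def curv_pos)

lemma has_real_derivative_comp_tau:
  assumes "g differentiable (at (\<tau> x))"
  shows "((\<lambda>x. g (\<tau> x)) has_real_derivative arcD f g (\<tau> x) / \<kappa> x) (at x)"
proof -
  have "(g has_real_derivative D g (\<tau> x)) (at (\<tau> x))"
    unfolding has_real_derivative_iff_has_vector_derivative by (rule has_D_if_differentiable[OF assms])
  from DERIV_chain2[OF this tau_deriv] show ?thesis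
    by (simp add: arcD_def \<kappa>_def turning_rate_def mult.commute)
qed

lemma kappa_deriv: "(\<kappa> has_real_derivative \<kappa> x * log_curv' x) (at x)"
  using has_real_derivative_comp_tau[OF curv_differentiable(1)[OF smooth D_nz]] kappa_pos[of x]
  by (simp add: \<kappa>_def[abs_def] log_curv'_def curv1_def power2_eq_square)

lemma log_curv_deriv: "(log_curv has_real_derivative log_curv' x) (at x)"
  unfolding log_curv_def[abs_def]
  using kappa_pos[of x] by (auto intro!: derivative_eq_intros kappa_deriv)

lemma log_curv'_deriv: "(log_curv' has_real_derivative log_curv'' x) (at x)"
proof -
  have "((\<lambda>x. curv1 f (\<tau> x)) has_real_derivative curv2 f (\<tau> x) / \<kappa> x) (at x)"
    using has_real_derivative_comp_tau[OF curv_differentiable(2)[OF smooth D_nz]]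
    by (simp add: curv1_def curv2_def)
  then show ?thesis
    unfolding log_curv'_def[abs_def] log_curv''_def
    using kappa_pos[of x]
    by (auto intro!: derivative_eq_intros kappa_deriv
        simp: log_curv'_def field_simps power2_eq_square power3_eq_cube)
qed

lemma point_deriv: "(point has_vector_derivative (1 / \<kappa> x) *\<^sub>R cis x) (at x)"
proof -
  have "(f \<circ> \<tau> has_vector_derivative (1 / (\<kappa> x * cmod (D f (\<tau> x)))) *\<^sub>R D f (\<tau> x)) (at x)"
    using tau_deriv[of x] unfolding has_real_derivative_iff_has_vector_derivative \<kappa>_def turning_rate_def
    by (rule vector_diff_chain_at) (rule smooth_fun_has_D[OF smooth])
  also have "D f (\<tau> x) = cmod (D f (\<tau> x)) *\<^sub>R cis x"
    using D_polar[of "\<tau> x"] by (simp add: scaleR_conv_of_real)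
  finally show ?thesis using D_nz[of "\<tau> x"] by (simp add: point_def[abs_def] o_def)
qed

lemma
  shows point_plus_turn: "point (x + 2 * pi * n) = point x"
    and log_curv_plus_turn: "log_curv (x + 2 * pi * n) = log_curv x"
    and log_curv'_plus_turn: "log_curv' (x + 2 * pi * n) = log_curv' x"
proof -
  note D_periodic = D_plus_period[of f 1, OF periodic]
  have curv: "curv f (t + 1) = curv f t" for t
    by (simp add: curv_def D_periodic D_plus_period[of "D f" 1, OF D_periodic])
  then have kappa: "\<kappa> (x + 2 * pi * n) = \<kappa> x" by (simp add: \<kappa>_def tau_plus_turn)
  show "point (x + 2 * pi * n) = point x" by (simp add: point_def tau_plus_turn periodic)
  show "log_curv (x + 2 * pi * n) = log_curv x" "log_curv' (x + 2 * pi * n) = log_curv' x"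
    by (simp_all add: log_curv_def log_curv'_def kappa tau_plus_turn
        curv1_def arcD_def D_periodic D_plus_period[of "curv f" 1, OF curv])
qed

end

section \<open>Branches of parallel pairs\<close>

lemma ecirc_eq_iff: "ecirc s = ecirc t \<longleftrightarrow> [s = t] (rmod 1)"
proof -
  have "ecirc s = ecirc t \<longleftrightarrow> (\<exists>j::int. 2 * pi * t = 2 * pi * s + of_int j * (2 * pi))"
    unfolding ecirc_def cis_eq_iff rcong_altdef ..
  also have "\<dots> \<longleftrightarrow> (\<exists>j::int. 2 * pi * t = 2 * pi * (s + of_int j))" by (simp only: algebra_simps)
  also have "\<dots> \<longleftrightarrow> [s = t] (rmod 1)" by (simp add: rcong_altdef)
  finally show ?thesis .
qed

lemma continuous_ecirc: "continuous_on S ecirc"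
  unfolding ecirc_def by (intro continuous_intros)

lemma rcong_of_int_mult_pi_iff:
  "[of_int l * pi = of_int m * pi] (rmod 2 * pi * of_nat n) \<longleftrightarrow> [l = m] (mod 2 * int n)"
proof -
  have "of_int m * pi = of_int l * pi + of_int j * (2 * pi * of_nat n) \<longleftrightarrow> m = l + 2 * int n * j" for j
  proof -
    have "of_int m * pi = of_int l * pi + of_int j * (2 * pi * of_nat n)
        \<longleftrightarrow> of_int m * pi = of_int (l + 2 * int n * j) * pi"
      by (simp add: algebra_simps)
    also have "\<dots> \<longleftrightarrow> m = l + 2 * int n * j" by (simp only: mult_cancel_right pi_neq_zero of_int_eq_iff simp_thms)
    finally show ?thesis .
  qed
  then show ?thesis by (simp add: rcong_altdef cong_iff_lin)
qed

lemma rcong_halve_modulus_iff: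
  "[x = y] (rmod L) \<longleftrightarrow> [x = y] (rmod 2 * L) \<or> [x = y + L] (rmod 2 * L)"
proof
  assume "[x = y] (rmod L)"
  then obtain j :: int where shift: "y = x + of_int j * L" by (auto simp: rcong_altdef)
  show "[x = y] (rmod 2 * L) \<or> [x = y + L] (rmod 2 * L)"
  proof (cases "even j")
    case True
    then obtain i where "j = 2 * i" by blast
    then show ?thesis using shift unfolding rcong_altdef by (intro disjI1 exI[of _ i]) simp
  next
    case False
    then obtain i where "j = 2 * i + 1" by (auto elim: oddE)
    then show ?thesis
      using shift unfolding rcong_altdef by (intro disjI2 exI[of _ "i + 1"]) (simp add: algebra_simps)
  qed
next
  assume "[x = y] (rmod 2 * L) \<or> [x = y + L] (rmod 2 * L)"
  then obtain j :: int where "y = x + of_int j * (2 * L) \<or> y + L = x + of_int j * (2 * L)"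
    by (auto simp: rcong_altdef)
  then have "y = x + of_int (2 * j) * L \<or> y = x + of_int (2 * j - 1) * L" by (auto simp: algebra_simps)
  then show "[x = y] (rmod L)" unfolding rcong_altdef by blast
qed

context rosette_angle
begin

definition circle_point :: "real \<Rightarrow> complex" where
  "circle_point x = ecirc (\<tau> x)"

definition angle_pair :: "int \<Rightarrow> real \<Rightarrow> complex \<times> complex" where
  "angle_pair m x = (circle_point x, circle_point (x + of_int m * pi))"

definition pair_family :: "int \<Rightarrow> (complex \<times> complex) set" where
  "pair_family m = range (angle_pair m)"

lemma ecirc_eq_circle_point: "ecirc t = circle_point (\<theta> t)"
  by (simp add: circle_point_def)

lemma circle_point_eq_iff: "circle_point x = circle_point y \<longleftrightarrow> [x = y] (rmod 2 * pi * n)"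
proof -
  have "\<theta> (t + of_int j) = \<theta> t + of_int j * (2 * pi * n)" for t j
    by (rule plus_of_int_if_plus_1) (rule theta_plus_1)
  then have "\<tau> y = \<tau> x + of_int j * 1 \<longleftrightarrow> y = x + of_int j * (2 * pi * n)" for j
    by (metis mult.right_neutral tau_theta theta_tau)
  then show ?thesis by (simp add: circle_point_def ecirc_eq_iff rcong_altdef)
qed

lemma angle_pair_eq_iff:
  "angle_pair l x = angle_pair m y \<longleftrightarrow> [x = y] (rmod 2 * pi * n) \<and> [l = m] (mod 2 * int n)"
proof -
  have "[x + of_int l * pi = y + of_int m * pi] (rmod 2 * pi * n)
      \<longleftrightarrow> [of_int l * pi = of_int m * pi] (rmod 2 * pi * n)"
    if "[x = y] (rmod 2 * pi * n)"
    using rcong_add[OF that] rcong_diff[OF _ that] by fastforce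
  then show ?thesis
    unfolding angle_pair_def prod.inject circle_point_eq_iff
    using rcong_of_int_mult_pi_iff by metis
qed

lemma swap_angle_pair: "prod.swap (angle_pair m x) = angle_pair (- m) (x + of_int m * pi)"
  by (simp add: angle_pair_def)

lemma ecirc_pair_eq_angle_pair:
  "\<theta> t = \<theta> s + of_int m * pi \<Longrightarrow> (ecirc s, ecirc t) = angle_pair m (\<theta> s)"
  by (simp add: angle_pair_def ecirc_eq_circle_point)

lemma angle_pair_in_family_iff: "angle_pair l x \<in> pair_family m \<longleftrightarrow> [l = m] (mod 2 * int n)"
  unfolding pair_family_def image_iff angle_pair_eq_iff by (auto intro: exI[of _ x])

lemma ecirc_pair_in_family_iff:
  "(ecirc s, ecirc t) \<in> pair_family m \<longleftrightarrow> (\<exists>l. \<theta> t = \<theta> s + of_int l * pi \<and> [l = m] (mod 2 * int n))"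
proof
  assume "(ecirc s, ecirc t) \<in> pair_family m"
  then obtain x where "[\<theta> s = x] (rmod 2 * pi * n)" "[\<theta> t = x + of_int m * pi] (rmod 2 * pi * n)"
    by (auto simp: pair_family_def angle_pair_def ecirc_eq_circle_point circle_point_eq_iff)
  then have "[\<theta> s + of_int m * pi = \<theta> t] (rmod 2 * pi * n)"
    by (meson rcong_add_right_cancel rcong_sym rcong_trans)
  then obtain j :: int where "\<theta> t = \<theta> s + of_int m * pi + of_int j * (2 * pi * n)" by (auto simp: rcong_altdef)
  then have "\<theta> t = \<theta> s + of_int (m + 2 * int n * j) * pi" by (simp add: algebra_simps)
  then show "\<exists>l. \<theta> t = \<theta> s + of_int l * pi \<and> [l = m] (mod 2 * int n)"
    by (intro exI[of _ "m + 2 * int n * j"]) (simp add: cong_def)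
qed (use ecirc_pair_eq_angle_pair angle_pair_in_family_iff in metis)

lemma D_mult_cnj_D: "D f s * cnj (D f t) = of_real (cmod (D f s) * cmod (D f t)) * cis (\<theta> s - \<theta> t)"
proof -
  have "cis (\<theta> s - \<theta> t) = cis (\<theta> s) * cnj (cis (\<theta> t))" by (simp add: cis_cnj cis_mult)
  then show ?thesis
    using arg_cong2[OF D_polar[of s] D_polar[of t], of "\<lambda>a b. a * cnj b"] by (simp add: algebra_simps)
qed

lemma parallel_pair_iff:
  "parallel_pair f s t \<longleftrightarrow> (\<exists>m. \<theta> t = \<theta> s + of_int m * pi \<and> \<not> [m = 0] (mod 2 * int n))"
proof -
  have "Im (D f s * cnj (D f t)) = 0 \<longleftrightarrow> sin (\<theta> t - \<theta> s) = 0"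
    unfolding D_mult_cnj_D using D_nz[of s] D_nz[of t] by (auto simp: sin_diff algebra_simps)
  also have "\<dots> \<longleftrightarrow> (\<exists>m::int. \<theta> t = \<theta> s + of_int m * pi)"
    by (simp add: sin_zero_iff_int2 algebra_simps)
  finally have parallel: "Im (D f s * cnj (D f t)) = 0 \<longleftrightarrow> (\<exists>m::int. \<theta> t = \<theta> s + of_int m * pi)" .
  have "ecirc s = ecirc t \<longleftrightarrow> [m = 0] (mod 2 * int n)" if "\<theta> t = \<theta> s + of_int m * pi" for m
    using rcong_of_int_mult_pi_iff[of 0 m n] rcong_add_left_cancel[of "\<theta> s" 0 "of_int m * pi"]
    by (simp add: ecirc_eq_circle_point circle_point_eq_iff that cong_sym_eq)
  then show ?thesis unfolding parallel_pair_def parallel by blast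
qed

lemma pp_set_eq: "pp_set f = {angle_pair m x | m x. \<not> [m = 0] (mod 2 * int n)}"
proof (intro equalityI subsetI)
  fix p assume "p \<in> pp_set f"
  then obtain s t m where "p = (ecirc s, ecirc t)" "\<theta> t = \<theta> s + of_int m * pi" "\<not> [m = 0] (mod 2 * int n)"
    unfolding pp_set_def parallel_pair_iff by blast
  then show "p \<in> {angle_pair m x | m x. \<not> [m = 0] (mod 2 * int n)}" using ecirc_pair_eq_angle_pair by blast
next
  fix p assume "p \<in> {angle_pair m x | m x. \<not> [m = 0] (mod 2 * int n)}"
  then obtain m x where p_eq: "p = angle_pair m x" and proper: "\<not> [m = 0] (mod 2 * int n)" by blast
  have "parallel_pair f (\<tau> x) (\<tau> (x + of_int m * pi))"
    unfolding parallel_pair_iff theta_tau using proper by blast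
  then show "p \<in> pp_set f" unfolding pp_set_def p_eq angle_pair_def circle_point_def by blast
qed

lemma continuous_angle_pair: "continuous_on S (angle_pair m)"
  unfolding angle_pair_def circle_point_def
  by (intro continuous_on_Pair continuous_on_compose2[OF continuous_ecirc[of UNIV]]
      continuous_on_compose2[OF continuous_tau[of UNIV]] continuous_intros) auto

lemma connected_pair_family: "connected (pair_family m)"
  unfolding pair_family_def by (intro connected_continuous_image continuous_angle_pair) simp

lemma closed_pair_family: "closed (pair_family m)"
proof -
  let ?L = "2 * pi * n"
  have "angle_pair m x \<in> angle_pair m ` {0..?L}" for x
  proof (rule image_eqI)
    show "angle_pair m x = angle_pair m (x rmod ?L)" by (simp add: angle_pair_eq_iff)
    show "x rmod ?L \<in> {0..?L}"
      using rmod_nonneg[of ?L x] rmod_le[of ?L x] n_pos by simp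
  qed
  then have "pair_family m = angle_pair m ` {0..?L}" by (auto simp: pair_family_def)
  then show ?thesis
    using compact_imp_closed[OF compact_continuous_image[OF continuous_angle_pair compact_Icc]] by metis
qed

lemma pair_family_cong: "[l = m] (mod 2 * int n) \<Longrightarrow> pair_family l = pair_family m"
  unfolding pair_family_def by (intro arg_cong[where f = range] ext) (simp add: angle_pair_eq_iff)

lemma disjnt_pair_family:
  assumes "\<not> [l = m] (mod 2 * int n)"
  shows "disjnt (pair_family l) (pair_family m)"
proof -
  have "angle_pair l x \<notin> pair_family m" for x
    using assms by (simp add: angle_pair_in_family_iff)
  then show ?thesis unfolding disjnt_iff pair_family_def[of l] by blast
qed

lemma swap_pair_family: "prod.swap ` pair_family m = pair_family (- m)"
proof -
  have "prod.swap ` pair_family m = angle_pair (- m) ` range (\<lambda>x. x + of_int m * pi)"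
    by (simp only: pair_family_def image_image swap_angle_pair)
  also have "range (\<lambda>x. x + of_int m * pi) = UNIV" by (metis surj_plus_right)
  finally show ?thesis by (simp add: pair_family_def)
qed

lemma cong_eq_if_bounded:
  assumes "[l = m] (mod M)" "l \<in> {0..<M}" "m \<in> {0..<M}"
  shows "l = (m :: int)"
  using assms by (simp add: cong_def)

lemma components_pp_set: "components (pp_set f) = pair_family ` {1..2 * int n - 1}"
proof -
  let ?\<C> = "pair_family ` {1..2 * int n - 1}"
  have "pp_set f = \<Union>?\<C>"
  proof (intro equalityI subsetI)
    fix p assume "p \<in> pp_set f"
    then obtain m x where p_eq: "p = angle_pair m x" "\<not> [m = 0] (mod 2 * int n)" unfolding pp_set_eq by blast
    let ?r = "m mod (2 * int n)"
    have "?r \<noteq> 0" "0 \<le> ?r" "?r < 2 * int n" using p_eq(2) n_pos by (simp_all add: cong_def)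
    then have "?r \<in> {1..2 * int n - 1}" by simp
    moreover have "p \<in> pair_family ?r" unfolding p_eq(1) angle_pair_in_family_iff by (simp add: cong_def)
    ultimately show "p \<in> \<Union>?\<C>" by blast
  next
    fix p assume "p \<in> \<Union>?\<C>"
    then obtain m x where p_in: "m \<in> {1..2 * int n - 1}" "p = angle_pair m x" by (auto simp: pair_family_def)
    then have "\<not> [m = 0] (mod 2 * int n)" using cong_eq_if_bounded[of m 0 "2 * int n"] by auto
    then show "p \<in> pp_set f" unfolding pp_set_eq p_in(2) by blast
  qed
  moreover have "pairwise disjnt ?\<C>"
    unfolding pairwise_def using disjnt_pair_family pair_family_cong by blast
  moreover have "pair_family m \<noteq> {}" for m by (simp add: pair_family_def)
  ultimately show ?thesis
    using closed_pair_family connected_pair_family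
    by (simp only:) (intro components_Union_finite_disjoint_closed, auto)
qed

definition branch :: "int \<Rightarrow> (complex \<times> complex) set" where
  "branch k = pair_family k \<union> pair_family (- k)"

definition in_branch :: "int \<Rightarrow> int \<Rightarrow> bool" where
  "in_branch k m \<longleftrightarrow> [m = k] (mod 2 * int n) \<or> [m = - k] (mod 2 * int n)"

lemma in_branch_refl: "in_branch k k"
  by (simp add: in_branch_def)

lemma angle_pair_in_branch_iff: "angle_pair m x \<in> branch k \<longleftrightarrow> in_branch k m"
  by (simp add: branch_def in_branch_def angle_pair_in_family_iff)

lemma ecirc_pair_in_branch_iff:
  "(ecirc s, ecirc t) \<in> branch k \<longleftrightarrow> (\<exists>m. \<theta> t = \<theta> s + of_int m * pi \<and> in_branch k m)"
  by (auto simp: branch_def in_branch_def ecirc_pair_in_family_iff)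

lemma in_branch_even_iff: "in_branch k m \<Longrightarrow> even m \<longleftrightarrow> even k"
  unfolding in_branch_def by (metis cong_dvd_iff cong_dvd_modulus dvd_triv_left even_minus)

lemma in_branch_not_cong_0:
  assumes "k \<in> {1..int n}" "in_branch k m"
  shows "\<not> [m = 0] (mod 2 * int n)"
proof
  assume "[m = 0] (mod 2 * int n)"
  then have "2 * int n dvd k"
    using assms(2) unfolding in_branch_def by (metis cong_0_iff cong_dvd_iff dvd_minus_iff dvd_refl)
  then show False using zdvd_imp_le[of "2 * int n" k] assms(1) by auto
qed

lemma branches_eq: "branches f = branch ` {1..int n}"
proof -
  have "branches f = (\<lambda>S. S \<union> prod.swap ` S) ` components (pp_set f)"
    unfolding branches_def by blast
  also have "\<dots> = branch ` {1..2 * int n - 1}"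
    unfolding components_pp_set image_image swap_pair_family branch_def ..
  also have "\<dots> = branch ` {1..int n}"
  proof (intro equalityI image_subsetI)
    fix k assume k: "k \<in> {1..2 * int n - 1}"
    have "branch k = branch (2 * int n - k)"
      unfolding branch_def
      using pair_family_cong[of "2 * int n - k" "- k"] pair_family_cong[of "- (2 * int n - k)" k]
      by (auto simp: cong_iff_dvd_diff)
    then show "branch k \<in> branch ` {1..int n}"
      using k by (cases "k \<le> int n") auto
  qed auto
  finally show ?thesis .
qed

lemma inj_on_branch: "inj_on branch {1..int n}"
proof (rule inj_onI)
  fix k l assume bounds: "k \<in> {1..int n}" "l \<in> {1..int n}" "branch k = branch l"
  then have "in_branch l k" using angle_pair_in_branch_iff in_branch_refl by metis
  then consider "[k = l] (mod 2 * int n)" | "2 * int n dvd k + l"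
    unfolding in_branch_def cong_iff_dvd_diff by auto
  then show "k = l"
  proof cases
    case 1
    then show ?thesis using bounds cong_eq_if_bounded[of k l "2 * int n"] by auto
  next
    case 2
    then show ?thesis using zdvd_imp_le[of "2 * int n" "k + l"] bounds by auto
  qed
qed

lemma card_branches_filter:
  assumes "\<And>k. k \<in> {1..int n} \<Longrightarrow> P (branch k) \<longleftrightarrow> Q k"
  shows "card {S \<in> branches f. P S} = card {k \<in> {1..int n}. Q k}"
proof -
  have "{S \<in> branches f. P S} = branch ` {k \<in> {1..int n}. Q k}"
    using assms by (auto simp: branches_eq)
  moreover have "inj_on branch {k \<in> {1..int n}. Q k}"
    by (rule inj_on_subset[OF inj_on_branch]) blast
  ultimately show ?thesis by (simp only: card_image)
qed

text \<open>The angle swept by a traversal of a branch: the family \<open>pair_family n\<close> is invariant under swapping,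
  so half a turn already exhausts its unordered pairs.\<close>

definition sweep :: "int \<Rightarrow> real" where
  "sweep k = (if k = int n then pi * n else 2 * pi * n)"

lemma sweep_pos: "sweep k > 0"
  using n_pos by (simp add: sweep_def)

lemma in_branch_n_iff: "in_branch (int n) m \<longleftrightarrow> [m = int n] (mod 2 * int n)"
proof -
  have "[- int n = int n] (mod 2 * int n)" by (simp add: cong_iff_dvd_diff)
  then show ?thesis unfolding in_branch_def by (meson cong_trans)
qed

lemma angle_pair_eq_or_swap_iff:
  assumes k_bounds: "k \<in> {1..int n}" and in_branch: "in_branch k m"
  shows "angle_pair m x = angle_pair m y \<or> angle_pair m x = prod.swap (angle_pair m y) \<longleftrightarrow> [x = y] (rmod sweep k)"
proof (cases "k = int n")
  case True
  then have cong_n: "[m = int n] (mod 2 * int n)" using in_branch in_branch_n_iff by simp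
  also have "[int n = - int n] (mod 2 * int n)" by (simp add: cong_iff_dvd_diff)
  also have "[- int n = - m] (mod 2 * int n)" using cong_n by (simp add: cong_minus_minus_iff cong_sym_eq)
  finally have "[m = - m] (mod 2 * int n)" .
  moreover have "[y + of_int m * pi = y + pi * n] (rmod 2 * pi * n)"
    using cong_n rcong_of_int_mult_pi_iff[of m "int n" n] by (simp add: mult.commute)
  then have "[x = y + of_int m * pi] (rmod 2 * pi * n) \<longleftrightarrow> [x = y + pi * n] (rmod 2 * pi * n)"
    unfolding rcong_def by simp
  ultimately show ?thesis
    using True rcong_halve_modulus_iff[of x y "pi * n"]
    by (simp add: swap_angle_pair angle_pair_eq_iff sweep_def mult.assoc)
next
  case False
  have "\<not> [m = - m] (mod 2 * int n)"
  proof
    assume "[m = - m] (mod 2 * int n)"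
    then have "int n dvd m" by (simp add: cong_iff_dvd_diff)
    then have "int n dvd k"
      using in_branch unfolding in_branch_def
      by (metis cong_dvd_iff cong_dvd_modulus dvd_minus_iff dvd_triv_right)
    then show False using zdvd_imp_le[of "int n" k] k_bounds False by auto
  qed
  then show ?thesis using False by (simp add: swap_angle_pair angle_pair_eq_iff sweep_def)
qed

end

subsection \<open>Differences along a branch\<close>

definition pair_diff :: "int \<Rightarrow> (real \<Rightarrow> 'a::real_vector) \<Rightarrow> real \<Rightarrow> 'a" where
  "pair_diff m H x = H (x + of_int m * pi) - H x"

lemma pair_diff_deriv:
  fixes H H' :: "real \<Rightarrow> real"
  assumes "\<And>x. (H has_real_derivative H' x) (at x)"
  shows "(pair_diff m H has_real_derivative pair_diff m H' x) (at x)"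
  unfolding pair_diff_def[abs_def]
  by (intro DERIV_diff assms) (simp add: assms flip: DERIV_shift)

context rosette_angle
begin

definition monodromy :: "int \<Rightarrow> real" where
  "monodromy k = (if k = int n then -1 else 1)"

lemma pair_diff_plus_sweep:
  fixes H :: "real \<Rightarrow> 'a::real_vector"
  assumes in_branch: "in_branch k m" and per: "\<And>x. H (x + 2 * pi * n) = H x"
  shows "pair_diff m H (x + sweep k) = monodromy k *\<^sub>R pair_diff m H x"
proof (cases "k = int n")
  case True
  note H_cong = periodic_eq_if_rcong[of H "2 * pi * n", OF per]
  have "[of_int m * pi = pi * n] (rmod 2 * pi * n)"
    using in_branch True in_branch_n_iff rcong_of_int_mult_pi_iff[of m "int n" n] by (simp add: mult.commute)
  then have "H (y + of_int m * pi) = H (y + pi * n)" for y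
    by (intro H_cong) (simp only: rcong_add_left_cancel)
  then have "H (x + of_int m * pi) = H (x + pi * n)"
    and "H (x + pi * n + of_int m * pi) = H (x + pi * n + pi * n)" by blast+
  moreover have "H (x + pi * n + pi * n) = H x"
    using per[of x] by (simp add: algebra_simps)
  ultimately show ?thesis using True by (simp add: pair_diff_def sweep_def monodromy_def)
next
  case False
  have "H (x + 2 * pi * n + of_int m * pi) = H (x + of_int m * pi)"
    using per[of "x + of_int m * pi"] by (simp add: algebra_simps)
  then show ?thesis using False by (simp add: pair_diff_def sweep_def monodromy_def per)
qed

end

section \<open>Velocities of the centre symmetry set and the Wigner caustic\<close>

abbreviation parity_sign :: "int \<Rightarrow> real" where
  "parity_sign m \<equiv> if even m then 1 else -1"

lemma cis_plus_of_int_mult_pi: "cis (x + of_int m * pi) = parity_sign m *\<^sub>R cis x"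
proof -
  have "cis (of_int m * pi) = of_real (parity_sign m)"
    by (simp add: complex_eq_iff mult.commute[of _ pi])
  then show ?thesis by (simp add: cis_mult[symmetric])
qed

context rosette_angle
begin

lemma tsgn_eq_sgn_cos: "tsgn f s t = sgn (cos (\<theta> t - \<theta> s))"
  unfolding tsgn_def D_mult_cnj_D using D_nz[of s] D_nz[of t]
  by (simp add: sgn_mult cos_diff mult.commute)

lemma ksum_eq_kappa:
  assumes "\<theta> t = \<theta> s + of_int m * pi"
  shows "ksum f s t = \<kappa> (\<theta> s) - parity_sign m * \<kappa> (\<theta> t)"
proof -
  have "tsgn f s t = parity_sign m" unfolding tsgn_eq_sgn_cos assms by (simp add: mult.commute[of _ pi])
  then show ?thesis by (simp add: ksum_def \<kappa>_def)
qed

lemma ksum_eq_0_iff: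
  assumes "\<theta> t = \<theta> s + of_int m * pi"
  shows "ksum f s t = 0 \<longleftrightarrow> even m \<and> pair_diff m log_curv (\<theta> s) = 0"
  unfolding ksum_eq_kappa[OF assms] pair_diff_def log_curv_def
  using kappa_pos[of "\<theta> s"] kappa_pos[of "\<theta> t"] by (auto simp: assms)

lemma kappa_comp_deriv:
  assumes "(A has_real_derivative c) (at u)"
  shows "((\<lambda>v. \<kappa> (A v)) has_real_derivative c * (\<kappa> (A u) * log_curv' (A u))) (at u)"
  using DERIV_chain2[OF kappa_deriv assms] by (simp add: mult.commute)

lemma point_comp_deriv:
  assumes "(A has_real_derivative c) (at u)"
  shows "((\<lambda>v. point (A v)) has_vector_derivative (c / \<kappa> (A u)) *\<^sub>R cis (A u)) (at u)"
  using vector_diff_chain_at[OF assms[unfolded has_real_derivative_iff_has_vector_derivative] point_deriv]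
  by (simp add: o_def)

definition css_point :: "int \<Rightarrow> real \<Rightarrow> real \<Rightarrow> complex" where
  "css_point m x y = (\<kappa> x *\<^sub>R point x + (- parity_sign m * \<kappa> y) *\<^sub>R point y) /\<^sub>R (\<kappa> x + - parity_sign m * \<kappa> y)"

lemma css_point_has_vector_derivative:
  assumes a_deriv: "(a has_real_derivative c) (at u)" and b_deriv: "(b has_real_derivative c) (at u)"
    and b_eq: "b u = a u + of_int m * pi" and nz: "\<kappa> (a u) - parity_sign m * \<kappa> (b u) \<noteq> 0"
  shows "((\<lambda>v. css_point m (a v) (b v)) has_vector_derivative
    (- c * parity_sign m * \<kappa> (a u) * \<kappa> (b u) / (\<kappa> (a u) - parity_sign m * \<kappa> (b u))\<^sup>2 * pair_diff m log_curv' (a u))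
      *\<^sub>R pair_diff m point (a u)) (at u)"
proof -
  define e where "e = parity_sign m"
  \<comment> \<open>The weighted tangent vectors cancel, so the velocity is parallel to the chord.\<close>
  have "cis (b u) = e *\<^sub>R cis (a u)" unfolding b_eq e_def by (rule cis_plus_of_int_mult_pi)
  then have tangents: "\<kappa> (a u) *\<^sub>R (c / \<kappa> (a u)) *\<^sub>R cis (a u)
      + (- e * \<kappa> (b u)) *\<^sub>R (c / \<kappa> (b u)) *\<^sub>R cis (b u) = 0"
    using kappa_pos[of "a u"] kappa_pos[of "b u"] by (simp add: e_def)
  have coeff: "c * (\<kappa> (a u) * log_curv' (a u)) * (- e * \<kappa> (b u))
      - \<kappa> (a u) * (- e * (c * (\<kappa> (b u) * log_curv' (b u))))
      = c * e * \<kappa> (a u) * \<kappa> (b u) * pair_diff m log_curv' (a u)"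
    unfolding pair_diff_def b_eq[symmetric] by (simp add: algebra_simps)
  have chord: "point (a u) - point (b u) = - pair_diff m point (a u)" by (simp add: pair_diff_def b_eq)
  have "\<kappa> (a u) + - e * \<kappa> (b u) \<noteq> 0" using nz by (simp add: e_def)
  from has_vector_derivative_weighted_mean[OF kappa_comp_deriv[OF a_deriv]
      DERIV_cmult[OF kappa_comp_deriv[OF b_deriv]] point_comp_deriv[OF a_deriv] point_comp_deriv[OF b_deriv] this]
  show ?thesis
    unfolding css_point_def e_def[symmetric] tangents coeff chord by simp
qed

text \<open>The pair is assumed parallel only at \<open>u\<close>: a traversal is unconstrained outside \<open>{0..1}\<close>, while \<open>D\<close> is
  the two-sided derivative also at the end points.\<close>

lemma eventually_css_eq_css_point:
  assumes cont: "isCont (\<lambda>v. \<theta> (s v)) u" "isCont (\<lambda>v. \<theta> (t v)) u"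
    and par: "\<theta> (t u) = \<theta> (s u) + of_int m * pi"
  shows "\<forall>\<^sub>F v in nhds u. css f (s v) (t v) = css_point m (\<theta> (s v)) (\<theta> (t v))"
proof -
  let ?e = "parity_sign m"
  have "isCont (\<lambda>v. ?e * cos (\<theta> (t v) - \<theta> (s v))) u" by (intro continuous_intros cont)
  moreover have pos: "0 < ?e * cos (\<theta> (t u) - \<theta> (s u))" by (simp add: par mult.commute[of _ pi])
  ultimately have "\<forall>\<^sub>F v in at u. 0 < ?e * cos (\<theta> (t v) - \<theta> (s v))"
    unfolding isCont_def by (rule order_tendstoD(1))
  then have "\<forall>\<^sub>F v in nhds u. 0 < ?e * cos (\<theta> (t v) - \<theta> (s v))"
    unfolding eventually_nhds_conv_at using pos by blast
  then show ?thesis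
  proof eventually_elim
    case (elim v)
    then have "tsgn f (s v) (t v) = ?e" by (auto simp: tsgn_eq_sgn_cos split: if_splits)
    then show ?case
      by (simp add: css_def css_point_def Let_def \<kappa>_def point_def scaleR_conv_of_real divide_inverse mult.commute)
  qed
qed

lemma css_has_vector_derivative:
  assumes s_deriv: "((\<lambda>v. \<theta> (s v)) has_real_derivative c) (at u)"
    and t_deriv: "((\<lambda>v. \<theta> (t v)) has_real_derivative c) (at u)"
    and par: "\<theta> (t u) = \<theta> (s u) + of_int m * pi"
    and nz: "ksum f (s u) (t u) \<noteq> 0"
  shows "((\<lambda>v. css f (s v) (t v)) has_vector_derivative
    (- c * parity_sign m * \<kappa> (\<theta> (s u)) * \<kappa> (\<theta> (t u)) / (ksum f (s u) (t u))\<^sup>2 * pair_diff m log_curv' (\<theta> (s u)))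
      *\<^sub>R pair_diff m point (\<theta> (s u))) (at u)"
proof -
  note ksum = ksum_eq_kappa[OF par]
  have near: "\<forall>\<^sub>F v in nhds u. css f (s v) (t v) = css_point m (\<theta> (s v)) (\<theta> (t v))"
    by (rule eventually_css_eq_css_point[OF DERIV_isCont[OF s_deriv] DERIV_isCont[OF t_deriv] par])
  show ?thesis
    using css_point_has_vector_derivative[OF s_deriv t_deriv par nz[unfolded ksum]] eventually_nhds_x_imp_x[OF near]
    by (subst has_vector_derivative_cong_ev[where g = "\<lambda>v. css_point m (\<theta> (s v)) (\<theta> (t v))"])
      (auto simp only: ksum intro: eventually_mono[OF near])
qed

lemma wigner_has_vector_derivative:
  assumes s_deriv: "((\<lambda>v. \<theta> (s v)) has_real_derivative c) (at u)"
    and t_deriv: "((\<lambda>v. \<theta> (t v)) has_real_derivative c) (at u)"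
    and par: "\<theta> (t u) = \<theta> (s u) + of_int m * pi"
  shows "((\<lambda>v. wigner f (s v) (t v)) has_vector_derivative
    (c / 2 * (1 / \<kappa> (\<theta> (s u)) + parity_sign m / \<kappa> (\<theta> (t u)))) *\<^sub>R cis (\<theta> (s u))) (at u)"
proof -
  have "((\<lambda>v. (1 / 2) *\<^sub>R (point (\<theta> (s v)) + point (\<theta> (t v)))) has_vector_derivative
    (1 / 2) *\<^sub>R ((c / \<kappa> (\<theta> (s u))) *\<^sub>R cis (\<theta> (s u)) + (c / \<kappa> (\<theta> (t u))) *\<^sub>R cis (\<theta> (t u)))) (at u)"
    by (intro bounded_linear.has_vector_derivative[OF bounded_linear_scaleR_right]
        has_vector_derivative_add point_comp_deriv s_deriv t_deriv)
  moreover have "wigner f (s v) (t v) = (1 / 2) *\<^sub>R (point (\<theta> (s v)) + point (\<theta> (t v)))" for v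
    by (simp add: wigner_def point_def scaleR_conv_of_real)
  moreover have "cis (\<theta> (t u)) = parity_sign m *\<^sub>R cis (\<theta> (s u))"
    unfolding par by (rule cis_plus_of_int_mult_pi)
  then have "(1 / 2) *\<^sub>R ((c / \<kappa> (\<theta> (s u))) *\<^sub>R cis (\<theta> (s u)) + (c / \<kappa> (\<theta> (t u))) *\<^sub>R cis (\<theta> (t u)))
    = (c / 2 * (1 / \<kappa> (\<theta> (s u)) + parity_sign m / \<kappa> (\<theta> (t u)))) *\<^sub>R cis (\<theta> (s u))"
    by (simp only: scaleR_scaleR scaleR_add_left[symmetric]) (simp add: distrib_left)
  ultimately show ?thesis by simp
qed

end

locale generic_rosette_angle = rosette_angle +
  assumes generic: "generic_rosette f n"
begin

lemma
  assumes "parallel_pair f s t"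
  shows parallel_points_distinct: "f s \<noteq> f t"
    and cusp_nondegenerate: "curv1 f s * curv f t ^ 2 = curv f s ^ 2 * curv1 f t
      \<Longrightarrow> curv2 f s * curv f t ^ 3 \<noteq> curv f s ^ 3 * curv2 f t"
    and asymptote_nondegenerate: "ksum f s t = 0 \<Longrightarrow> curv1 f s * curv f t ^ 2 \<noteq> curv f s ^ 2 * curv1 f t"
proof -
  show "f s \<noteq> f t" using generic assms unfolding generic_rosette_def parallel_pair_def by (elim conjE) blast
  show "curv2 f s * curv f t ^ 3 \<noteq> curv f s ^ 3 * curv2 f t"
    if "curv1 f s * curv f t ^ 2 = curv f s ^ 2 * curv1 f t"
    using generic assms that unfolding generic_rosette_def by (elim conjE) blast
  show "curv1 f s * curv f t ^ 2 \<noteq> curv f s ^ 2 * curv1 f t" if "ksum f s t = 0"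
    using generic assms that unfolding generic_rosette_def by (elim conjE) blast
qed

lemma parallel_pair_tau:
  assumes "\<not> [m = 0] (mod 2 * int n)"
  shows "parallel_pair f (\<tau> x) (\<tau> (x + of_int m * pi))"
  unfolding parallel_pair_iff theta_tau using assms by blast

lemma chord_nz:
  assumes "\<not> [m = 0] (mod 2 * int n)"
  shows "pair_diff m point x \<noteq> 0"
  using parallel_points_distinct[OF parallel_pair_tau[OF assms, of x]] by (simp add: pair_diff_def point_def)

lemma simple_zeros_log_curv':
  assumes proper: "\<not> [m = 0] (mod 2 * int n)"
  shows "simple_zeros (pair_diff m log_curv') (pair_diff m log_curv'')"
proof
  fix x
  show "(pair_diff m log_curv' has_real_derivative pair_diff m log_curv'' x) (at x)"
    by (rule pair_diff_deriv[OF log_curv'_deriv])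
  define y where "y = x + of_int m * pi"
  have pos: "\<kappa> x > 0" "\<kappa> y > 0" by (rule kappa_pos)+
  assume "pair_diff m log_curv' x = 0"
  then have log_slope: "log_curv' y = log_curv' x" by (simp add: pair_diff_def y_def)
  then have curv1: "curv1 f (\<tau> x) * \<kappa> y ^ 2 = \<kappa> x ^ 2 * curv1 f (\<tau> y)"
    using pos by (simp add: log_curv'_def field_simps)
  show "pair_diff m log_curv'' x \<noteq> 0"
  proof
    assume "pair_diff m log_curv'' x = 0"
    then have "curv2 f (\<tau> x) / \<kappa> x ^ 3 = curv2 f (\<tau> y) / \<kappa> y ^ 3"
      unfolding pair_diff_def y_def[symmetric] log_curv''_def log_slope by simp
    then have "curv2 f (\<tau> x) * \<kappa> y ^ 3 = \<kappa> x ^ 3 * curv2 f (\<tau> y)"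
      using pos by (simp add: field_simps)
    then show False
      using cusp_nondegenerate[OF parallel_pair_tau[OF proper, of x]] curv1 by (simp add: \<kappa>_def y_def)
  qed
qed

lemma simple_zeros_log_curv:
  assumes proper: "\<not> [m = 0] (mod 2 * int n)" and "even m"
  shows "simple_zeros (pair_diff m log_curv) (pair_diff m log_curv')"
proof
  fix x
  show "(pair_diff m log_curv has_real_derivative pair_diff m log_curv' x) (at x)"
    by (rule pair_diff_deriv[OF log_curv_deriv])
  define y where "y = x + of_int m * pi"
  have pos: "\<kappa> x > 0" "\<kappa> y > 0" by (rule kappa_pos)+
  assume "pair_diff m log_curv x = 0"
  moreover have "\<theta> (\<tau> y) = \<theta> (\<tau> x) + of_int m * pi" by (simp add: y_def)
  ultimately have ksum: "ksum f (\<tau> x) (\<tau> y) = 0"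
    using \<open>even m\<close> by (simp only: ksum_eq_0_iff theta_tau simp_thms)
  show "pair_diff m log_curv' x \<noteq> 0"
  proof
    assume "pair_diff m log_curv' x = 0"
    then have "log_curv' y = log_curv' x" by (simp add: pair_diff_def y_def)
    then have "curv1 f (\<tau> x) * \<kappa> y ^ 2 = \<kappa> x ^ 2 * curv1 f (\<tau> y)"
      using pos by (simp add: log_curv'_def field_simps)
    then show False
      using asymptote_nondegenerate[OF parallel_pair_tau[OF proper, of x]] ksum by (simp add: \<kappa>_def y_def)
  qed
qed

end

section \<open>Traversals\<close>

context rosette_angle
begin

definition angle_path :: "int \<Rightarrow> real \<Rightarrow> real \<times> real" where
  "angle_path k u = (\<tau> (sweep k * u), \<tau> (sweep k * u + of_int k * pi))"

lemma
  shows angle_path_differentiable: "angle_path k differentiable (at u)"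
    and D_angle_path_nz: "D (angle_path k) u \<noteq> 0"
proof -
  define speed where "speed x = 1 / turning_rate f (\<tau> x) * sweep k" for x
  have "((\<lambda>u. sweep k * u + c) has_real_derivative sweep k) (at u)" for c
    by (auto intro!: derivative_eq_intros)
  from DERIV_chain2[OF tau_deriv this]
  have tau: "((\<lambda>u. \<tau> (sweep k * u + c)) has_vector_derivative speed (sweep k * u + c)) (at u)" for c
    by (simp add: speed_def has_real_derivative_iff_has_vector_derivative)
  have "(angle_path k has_vector_derivative (speed (sweep k * u), speed (sweep k * u + of_int k * pi))) (at u)"
    unfolding angle_path_def[abs_def] using tau[of 0] tau by (intro has_vector_derivative_Pair) simp_all
  moreover have "speed x \<noteq> 0" for x
    using sweep_pos[of k] turning_rate_pos[of "\<tau> x"] by (simp add: speed_def)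
  ultimately show "angle_path k differentiable (at u)" "D (angle_path k) u \<noteq> 0"
    by (auto simp: D_eqI zero_prod_def intro: differentiableI_vector)
qed

lemma angle_pair_inj_on_sweep:
  assumes k_bounds: "k \<in> {1..int n}" and "x \<in> {0..<sweep k}" "y \<in> {0..<sweep k}" "x \<noteq> y"
  shows "angle_pair k x \<noteq> angle_pair k y" and "angle_pair k x \<noteq> prod.swap (angle_pair k y)"
proof -
  have "\<not> [x = y] (rmod sweep k)"
  proof
    assume "[x = y] (rmod sweep k)"
    moreover have "\<bar>x - y\<bar> < \<bar>sweep k\<bar>" using assms(2,3) by (simp add: abs_less_iff)
    ultimately show False using rcong_imp_eq assms(4) by blast
  qed
  then show "angle_pair k x \<noteq> angle_pair k y" "angle_pair k x \<noteq> prod.swap (angle_pair k y)"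
    using angle_pair_eq_or_swap_iff[OF k_bounds in_branch_refl] by blast+
qed

lemma branch_subset_sweep:
  assumes k_bounds: "k \<in> {1..int n}"
  shows "branch k \<subseteq> angle_pair k ` {0..sweep k} \<union> prod.swap ` angle_pair k ` {0..sweep k}"
proof -
  let ?U = "angle_pair k ` {0..sweep k} \<union> prod.swap ` angle_pair k ` {0..sweep k}"
  have "angle_pair k x \<in> ?U" for x
  proof -
    have "angle_pair k x = angle_pair k (x rmod sweep k)
        \<or> angle_pair k x = prod.swap (angle_pair k (x rmod sweep k))"
      by (simp add: angle_pair_eq_or_swap_iff[OF k_bounds in_branch_refl])
    moreover have "x rmod sweep k \<in> {0..sweep k}"
      using rmod_nonneg[of "sweep k" x] rmod_le[of "sweep k" x] sweep_pos[of k] by simp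
    ultimately show ?thesis by blast
  qed
  then have family: "pair_family k \<subseteq> ?U" unfolding pair_family_def by blast
  have "pair_family (- k) = prod.swap ` pair_family k" by (rule swap_pair_family[symmetric])
  also have "\<dots> \<subseteq> prod.swap ` ?U" by (rule image_mono[OF family])
  also have "\<dots> = ?U" by (auto simp: image_Un image_image)
  finally show ?thesis using family by (simp only: branch_def Un_subset_iff)
qed

lemma traversal_angle_path:
  assumes k_bounds: "k \<in> {1..int n}"
  shows "traversal f (branch k) (angle_path k)"
proof -
  define P where "P u = angle_pair k (sweep k * u)" for u
  have pair: "(ecirc (fst (angle_path k u)), ecirc (snd (angle_path k u))) = P u" for u
    by (simp add: angle_path_def P_def angle_pair_def circle_point_def)
  have "P ` {0..1} = angle_pair k ` (*) (sweep k) ` {0..1}" by (simp add: P_def[abs_def] image_image)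
  also have "(*) (sweep k) ` {0..1} = {0..sweep k}" using sweep_pos[of k] by simp
  finally have image: "P ` {0..1} = angle_pair k ` {0..sweep k}" .
  have in_branch: "P u \<in> branch k" for u by (simp add: P_def angle_pair_in_branch_iff in_branch_refl)
  have closed: "P 1 = P 0 \<or> P 1 = prod.swap (P 0)"
    unfolding P_def angle_pair_eq_or_swap_iff[OF k_bounds in_branch_refl] by (simp add: rcong_def)
  have inj: "P u \<noteq> P v" "P u \<noteq> prod.swap (P v)" if "u \<in> {0..<1}" "v \<in> {0..<1}" "u \<noteq> v" for u v
    unfolding P_def using that sweep_pos[of k] by (intro angle_pair_inj_on_sweep[OF k_bounds]; simp)+
  show ?thesis
    unfolding traversal_def Let_def pair image
    by (intro conjI ballI impI angle_path_differentiable D_angle_path_nz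
        in_branch closed inj branch_subset_sweep[OF k_bounds])
qed

end

locale rosette_traversal = rosette_angle +
  fixes k :: int and \<gamma> :: "real \<Rightarrow> real \<times> real"
  assumes k_bounds: "k \<in> {1..int n}" and traversal: "traversal f (branch k) \<gamma>"
begin

definition fst_angle :: "real \<Rightarrow> real" where "fst_angle u = \<theta> (fst (\<gamma> u))"
definition snd_angle :: "real \<Rightarrow> real" where "snd_angle u = \<theta> (snd (\<gamma> u))"
definition pair_at :: "real \<Rightarrow> complex \<times> complex" where
  "pair_at u = (ecirc (fst (\<gamma> u)), ecirc (snd (\<gamma> u)))"
definition offset :: int where "offset = \<lfloor>(snd_angle 0 - fst_angle 0) / pi\<rfloor>"

abbreviation ksum_path :: "real \<Rightarrow> real" where "ksum_path u \<equiv> ksum f (fst (\<gamma> u)) (snd (\<gamma> u))"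
abbreviation css_path :: "real \<Rightarrow> complex" where "css_path u \<equiv> css f (fst (\<gamma> u)) (snd (\<gamma> u))"
abbreviation wigner_path :: "real \<Rightarrow> complex" where "wigner_path u \<equiv> wigner f (fst (\<gamma> u)) (snd (\<gamma> u))"

lemma
  shows gamma_differentiable: "u \<in> {0..1} \<Longrightarrow> \<gamma> differentiable (at u)"
    and D_gamma_nz: "u \<in> {0..1} \<Longrightarrow> D \<gamma> u \<noteq> 0"
    and pair_at_in_branch: "u \<in> {0..1} \<Longrightarrow> pair_at u \<in> branch k"
    and pair_at_closed: "pair_at 1 = pair_at 0 \<or> pair_at 1 = prod.swap (pair_at 0)"
    and pair_at_inj: "\<lbrakk>u \<in> {0..<1}; v \<in> {0..<1};
      pair_at u = pair_at v \<or> pair_at u = prod.swap (pair_at v)\<rbrakk> \<Longrightarrow> u = v"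
    and branch_covered: "branch k \<subseteq> pair_at ` {0..1} \<union> prod.swap ` pair_at ` {0..1}"
proof -
  note unfolded = traversal[unfolded traversal_def Let_def, folded pair_at_def pair_at_def[abs_def]]
  show "\<gamma> differentiable (at u)" "D \<gamma> u \<noteq> 0" "pair_at u \<in> branch k" if "u \<in> {0..1}"
    using unfolded[THEN conjunct1] that by blast+
  show "pair_at 1 = pair_at 0 \<or> pair_at 1 = prod.swap (pair_at 0)"
    by (rule unfolded[THEN conjunct2, THEN conjunct1])
  show "u = v" if "u \<in> {0..<1}" "v \<in> {0..<1}" "pair_at u = pair_at v \<or> pair_at u = prod.swap (pair_at v)"
    using unfolded[THEN conjunct2, THEN conjunct2, THEN conjunct1] that by metis
  show "branch k \<subseteq> pair_at ` {0..1} \<union> prod.swap ` pair_at ` {0..1}"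
    by (rule unfolded[THEN conjunct2, THEN conjunct2, THEN conjunct2])
qed

lemma
  assumes "u \<in> {0..1}"
  shows fst_angle_deriv: "(fst_angle has_real_derivative turning_rate f (fst (\<gamma> u)) * fst (D \<gamma> u)) (at u)"
    and snd_angle_deriv: "(snd_angle has_real_derivative turning_rate f (snd (\<gamma> u)) * snd (D \<gamma> u)) (at u)"
proof -
  have "(\<gamma> has_vector_derivative D \<gamma> u) (at u)"
    by (rule has_D_if_differentiable[OF gamma_differentiable[OF assms]])
  then have fst: "((\<lambda>v. fst (\<gamma> v)) has_real_derivative fst (D \<gamma> u)) (at u)"
    and snd: "((\<lambda>v. snd (\<gamma> v)) has_real_derivative snd (D \<gamma> u)) (at u)"
    unfolding has_real_derivative_iff_has_vector_derivative
    by (rule bounded_linear.has_vector_derivative[OF bounded_linear_fst]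
        bounded_linear.has_vector_derivative[OF bounded_linear_snd])+
  show "(fst_angle has_real_derivative turning_rate f (fst (\<gamma> u)) * fst (D \<gamma> u)) (at u)"
    "(snd_angle has_real_derivative turning_rate f (snd (\<gamma> u)) * snd (D \<gamma> u)) (at u)"
    unfolding fst_angle_def[abs_def] snd_angle_def[abs_def]
    by (rule DERIV_chain2[OF theta_deriv fst] DERIV_chain2[OF theta_deriv snd])+
qed

lemma continuous_fst_angle: "continuous_on {0..1} fst_angle"
  and continuous_snd_angle: "continuous_on {0..1} snd_angle"
  using fst_angle_deriv[THEN DERIV_isCont] snd_angle_deriv[THEN DERIV_isCont]
  by (auto intro: continuous_at_imp_continuous_on)

lemma snd_angle_eq_offset: "u \<in> {0..1} \<Longrightarrow> snd_angle u = fst_angle u + of_int offset * pi"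
  and in_branch_offset: "in_branch k offset"
proof -
  have pair: "\<exists>m. snd_angle u = fst_angle u + of_int m * pi \<and> in_branch k m" if "u \<in> {0..1}" for u
    using pair_at_in_branch[OF that] unfolding pair_at_def fst_angle_def snd_angle_def ecirc_pair_in_branch_iff .
  have "(\<lambda>u. (snd_angle u - fst_angle u) / pi) constant_on {0..1}"
  proof (rule continuous_on_Ints_constant_on)
    show "continuous_on {0..1} (\<lambda>u. (snd_angle u - fst_angle u) / pi)"
      by (intro continuous_intros continuous_fst_angle continuous_snd_angle) auto
    show "(snd_angle u - fst_angle u) / pi \<in> \<int>" if "u \<in> {0..1}" for u using pair[OF that] by auto
  qed simp
  then obtain q where const: "\<And>u. u \<in> {0..1} \<Longrightarrow> (snd_angle u - fst_angle u) / pi = q"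
    unfolding constant_on_def by blast
  obtain m where at_0: "snd_angle 0 = fst_angle 0 + of_int m * pi" "in_branch k m" using pair[of 0] by auto
  then have "offset = m" by (simp add: offset_def)
  with at_0(2) show "in_branch k offset" by simp
  show "snd_angle u = fst_angle u + of_int offset * pi" if "u \<in> {0..1}"
    using const[OF that] const[of 0] at_0(1) \<open>offset = m\<close> by (simp add: field_simps)
qed

lemma offset_not_cong_0: "\<not> [offset = 0] (mod 2 * int n)"
  by (rule in_branch_not_cong_0[OF k_bounds in_branch_offset])

lemma equal_angular_speeds:
  assumes u_in: "u \<in> {0..1}"
  obtains c where "c \<noteq> 0" "(fst_angle has_real_derivative c) (at u)" "(snd_angle has_real_derivative c) (at u)"
proof -
  define c where "c = turning_rate f (fst (\<gamma> u)) * fst (D \<gamma> u)"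
  define c' where "c' = turning_rate f (snd (\<gamma> u)) * snd (D \<gamma> u)"
  note fst_deriv = fst_angle_deriv[OF u_in, folded c_def] and snd_deriv = snd_angle_deriv[OF u_in, folded c'_def]
  have "c' = c"
  proof (rule vector_derivative_unique_within_closed_interval)
    show "(snd_angle has_vector_derivative c') (at u within cbox 0 1)"
      using snd_deriv by (simp add: has_real_derivative_iff_has_vector_derivative has_vector_derivative_at_within)
    have "((\<lambda>u. fst_angle u + of_int offset * pi) has_real_derivative c) (at u)"
      using fst_deriv by (auto intro!: derivative_eq_intros)
    then have "((\<lambda>u. fst_angle u + of_int offset * pi) has_vector_derivative c) (at u within {0..1})"
      by (simp add: has_real_derivative_iff_has_vector_derivative has_vector_derivative_at_within)
    then show "(snd_angle has_vector_derivative c) (at u within cbox 0 1)"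
      unfolding cbox_interval
      by (rule has_vector_derivative_transform[OF u_in, rotated]) (simp add: snd_angle_eq_offset)
  qed (use u_in in auto)
  moreover have "c \<noteq> 0 \<or> c' \<noteq> 0"
    using D_gamma_nz[OF u_in] turning_rate_pos[of "fst (\<gamma> u)"] turning_rate_pos[of "snd (\<gamma> u)"]
    by (auto simp: c_def c'_def prod_eq_iff)
  ultimately show ?thesis using that fst_deriv snd_deriv by blast
qed

lemma pair_at_eq_angle_pair: "u \<in> {0..1} \<Longrightarrow> pair_at u = angle_pair offset (fst_angle u)"
  using ecirc_pair_eq_angle_pair snd_angle_eq_offset by (simp add: pair_at_def fst_angle_def snd_angle_def)

lemma angle_pair_offset_eq_or_swap_iff:
  "angle_pair offset x = angle_pair offset y \<or> angle_pair offset x = prod.swap (angle_pair offset y)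
    \<longleftrightarrow> [x = y] (rmod sweep k)"
  by (rule angle_pair_eq_or_swap_iff[OF k_bounds in_branch_offset])

lemma fst_angle_closed: "[fst_angle 1 = fst_angle 0] (rmod sweep k)"
  using pair_at_closed by (simp add: pair_at_eq_angle_pair angle_pair_offset_eq_or_swap_iff)

lemma fst_angle_inj:
  assumes "u \<in> {0..<1}" "v \<in> {0..<1}" "[fst_angle u = fst_angle v] (rmod sweep k)"
  shows "u = v"
  using assms by (intro pair_at_inj) (simp_all add: pair_at_eq_angle_pair angle_pair_offset_eq_or_swap_iff)

lemma fst_angle_covers: "\<exists>u\<in>{0..<1}. [fst_angle u = x] (rmod sweep k)"
proof -
  have "angle_pair offset x \<in> branch k" by (simp add: angle_pair_in_branch_iff in_branch_offset)
  then obtain u where u_in: "u \<in> {0..1}"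
    "angle_pair offset x = pair_at u \<or> angle_pair offset x = prod.swap (pair_at u)"
    using branch_covered by blast
  then have cong: "[x = fst_angle u] (rmod sweep k)"
    by (simp add: pair_at_eq_angle_pair angle_pair_offset_eq_or_swap_iff)
  show ?thesis
  proof (cases "u = 1")
    case True
    then have "[fst_angle 0 = x] (rmod sweep k)" using cong fst_angle_closed by (simp add: rcong_def)
    then show ?thesis by (intro bexI[of _ 0]) auto
  next
    case False
    then show ?thesis using cong u_in(1) by (intro bexI[of _ u]) (auto simp: rcong_sym_iff)
  qed
qed

lemma fundamental_domain_fst_angle: "fundamental_domain (sweep k) (fst_angle ` {0..<1})"
  unfolding fundamental_domain_def
proof (intro allI ex_ex1I)
  show "\<exists>x. x \<in> fst_angle ` {0..<1} \<and> [x = y] (rmod sweep k)" for y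
    using fst_angle_covers[of y] by blast
  show "x = x'" if "x \<in> fst_angle ` {0..<1} \<and> [x = y] (rmod sweep k)"
    "x' \<in> fst_angle ` {0..<1} \<and> [x' = y] (rmod sweep k)" for x x' y
  proof -
    from that obtain u v where "x = fst_angle u" "x' = fst_angle v" "u \<in> {0..<1}" "v \<in> {0..<1}" by blast
    moreover have "[x = x'] (rmod sweep k)" using that by (simp add: rcong_def)
    ultimately show ?thesis using fst_angle_inj by blast
  qed
qed

lemma card_fst_angle_vimage: "card {u \<in> {0..<1}. P (fst_angle u)} = card {x \<in> fst_angle ` {0..<1}. P x}"
proof -
  have "inj_on fst_angle {u \<in> {0..<1}. P (fst_angle u)}"
    by (rule inj_onI) (auto intro: fst_angle_inj simp: rcong_def)
  moreover have "{x \<in> fst_angle ` {0..<1}. P x} = fst_angle ` {u \<in> {0..<1}. P (fst_angle u)}" by blast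
  ultimately show ?thesis by (simp only: card_image)
qed

lemma fst_angle_ends: "\<bar>fst_angle 1 - fst_angle 0\<bar> = sweep k"
proof (rule simple_loop_winds_once[OF continuous_fst_angle sweep_pos])
  show "[fst_angle 0 = fst_angle 1] (rmod sweep k)" using fst_angle_closed by (rule rcong_sym)
  show "fst_angle 1 \<noteq> fst_angle 0"
  proof
    assume "fst_angle 1 = fst_angle 0"
    moreover have "fst_angle differentiable (at u)" if "0 < u" "u < 1" for u
      using fst_angle_deriv[of u] that by (auto simp: real_differentiable_def)
    ultimately obtain z where crit: "0 < z" "z < 1" "(fst_angle has_real_derivative 0) (at z)"
      using Rolle[of 0 1 fst_angle] continuous_fst_angle by auto
    then obtain c where "c \<noteq> 0" "(fst_angle has_real_derivative c) (at z)"
      using equal_angular_speeds[of z] by auto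
    with crit(3) show False using DERIV_unique by blast
  qed
qed (rule fst_angle_inj)

end

section \<open>Asymptotes, cusps and rotation numbers\<close>

lemma cis_2pi_eq_1_iff: "cis (2 * pi * x) = 1 \<longleftrightarrow> x \<in> \<int>"
proof -
  have "cis (2 * pi * x) = 1 \<longleftrightarrow> (\<exists>j::int. x = of_int j)" by (simp add: cis_eq_1_iff)
  then show ?thesis by (auto elim: Ints_cases)
qed

lemma cis_2pi_eq_minus_1_iff: "cis (2 * pi * x) = -1 \<longleftrightarrow> x - 1/2 \<in> \<int>"
proof -
  have "cis (2 * pi * (x - 1/2)) = - cis (2 * pi * x)"
    by (simp add: right_diff_distrib flip: cis_divide)
  then show ?thesis using cis_2pi_eq_1_iff[of "x - 1/2"] by (auto simp: minus_equation_iff)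
qed

lemma card_even_int_Icc: "card {k \<in> {1..int n}. even k} = n div 2"
proof -
  have "{k \<in> {1..int n}. even k} = (\<lambda>j. 2 * j) ` {1..int (n div 2)}"
    by (auto simp: zdiv_int elim!: evenE)
  then show ?thesis by (simp add: card_image inj_on_def)
qed

context rosette_angle
begin

lemma has_asymptote_iff: "has_asymptote f (branch k) \<longleftrightarrow> even k"
proof
  assume "has_asymptote f (branch k)"
  then obtain s t where st_pair: "(ecirc s, ecirc t) \<in> branch k" "ksum f s t = 0"
    unfolding has_asymptote_def by blast
  then obtain m where "\<theta> t = \<theta> s + of_int m * pi" "in_branch k m" unfolding ecirc_pair_in_branch_iff by blast
  then show "even k" using st_pair(2) ksum_eq_0_iff in_branch_even_iff by blast
next
  assume "even k"
  have "continuous_on UNIV log_curv"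
    using log_curv_deriv by (meson DERIV_isCont continuous_at_imp_continuous_on)
  then obtain x where "log_curv (x + of_int k * pi) = log_curv x"
    using continuous_periodic_ex_translate_eq[of log_curv "2 * pi * n"] log_curv_plus_turn n_pos by auto
  then have "ksum f (\<tau> x) (\<tau> (x + of_int k * pi)) = 0"
    using ksum_eq_0_iff[of "\<tau> (x + of_int k * pi)" "\<tau> x" k] \<open>even k\<close> by (simp add: pair_diff_def)
  moreover have "(ecirc (\<tau> x), ecirc (\<tau> (x + of_int k * pi))) \<in> branch k"
    using angle_pair_in_branch_iff in_branch_refl by (simp flip: circle_point_def angle_pair_def)
  ultimately show "has_asymptote f (branch k)" unfolding has_asymptote_def by blast
qed

end

context rosette_traversal
begin

lemma monodromy_cases: "monodromy k = 1 \<or> monodromy k = -1"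
  by (simp add: monodromy_def)

lemma
  shows log_curv_diff_plus_sweep:
      "pair_diff offset log_curv (x + sweep k) = monodromy k * pair_diff offset log_curv x"
    and log_curv'_diff_plus_sweep:
      "pair_diff offset log_curv' (x + sweep k) = monodromy k * pair_diff offset log_curv' x"
    and point_diff_plus_sweep:
      "pair_diff offset point (x + sweep k) = of_real (monodromy k) * pair_diff offset point x"
  by (simp_all add: pair_diff_plus_sweep[OF in_branch_offset]
      log_curv_plus_turn log_curv'_plus_turn point_plus_turn scaleR_conv_of_real)

lemma snd_gamma_eq: "u \<in> {0..1} \<Longrightarrow> \<theta> (snd (\<gamma> u)) = \<theta> (fst (\<gamma> u)) + of_int offset * pi"
  using snd_angle_eq_offset by (simp add: fst_angle_def snd_angle_def)

definition chord :: "real \<Rightarrow> complex" where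
  "chord u = pair_diff offset point (fst_angle u)"

lemma css_velocity:
  assumes u_in: "u \<in> {0..1}" and nz: "ksum_path u \<noteq> 0"
  obtains r where "r \<noteq> 0" "D css_path u
    = (r * pair_diff offset log_curv' (fst_angle u)) *\<^sub>R chord u"
proof -
  obtain c where speed: "c \<noteq> 0"
    "(fst_angle has_real_derivative c) (at u)" "(snd_angle has_real_derivative c) (at u)"
    by (rule equal_angular_speeds[OF u_in])
  note D_eqI[OF css_has_vector_derivative[OF speed(2,3)[unfolded fst_angle_def[abs_def] snd_angle_def[abs_def]]
        snd_gamma_eq[OF u_in] nz], folded fst_angle_def, folded chord_def]
  moreover have "- c * parity_sign offset * \<kappa> (fst_angle u) * \<kappa> (\<theta> (snd (\<gamma> u))) / (ksum_path u)\<^sup>2 \<noteq> 0"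
    using speed(1) nz kappa_pos[of "fst_angle u"] kappa_pos[of "\<theta> (snd (\<gamma> u))"] by auto
  ultimately show ?thesis by (rule that[rotated])
qed

lemma wigner_velocity_eq_0_iff:
  assumes u_in: "u \<in> {0..1}" and "odd k"
  shows "D wigner_path u = 0 \<longleftrightarrow> pair_diff offset log_curv (fst_angle u) = 0"
proof -
  obtain c where speed: "c \<noteq> 0"
    "(fst_angle has_real_derivative c) (at u)" "(snd_angle has_real_derivative c) (at u)"
    by (rule equal_angular_speeds[OF u_in])
  have "odd offset" using \<open>odd k\<close> in_branch_even_iff[OF in_branch_offset] by simp
  note D_eqI[OF wigner_has_vector_derivative[OF speed(2,3)[unfolded fst_angle_def[abs_def] snd_angle_def[abs_def]]
        snd_gamma_eq[OF u_in]], folded fst_angle_def]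
  then show ?thesis
    using speed(1) \<open>odd offset\<close> kappa_pos[of "fst_angle u"]
      kappa_pos[of "fst_angle u + of_int offset * pi"] snd_gamma_eq[OF u_in]
    by (auto simp: pair_diff_def log_curv_def fst_angle_def)
qed

end

locale generic_rosette_traversal = generic_rosette_angle + rosette_traversal
begin

lemma chord_neq_0: "chord u \<noteq> 0"
  by (simp add: chord_def chord_nz offset_not_cong_0)

lemma css_cusps_eq: "css_cusps f \<gamma> = {u \<in> {0..<1}. pair_diff offset log_curv' (fst_angle u) = 0}"
proof -
  have "(ksum_path u \<noteq> 0 \<and> D css_path u = 0)
      \<longleftrightarrow> pair_diff offset log_curv' (fst_angle u) = 0" if "u \<in> {0..<1}" for u
  proof (cases "ksum_path u = 0")
    case True
    then have "even offset" "pair_diff offset log_curv (fst_angle u) = 0"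
      using ksum_eq_0_iff[OF snd_gamma_eq, of u] that by (auto simp: fst_angle_def)
    then show ?thesis
      using True simple_zeros.simple[OF simple_zeros_log_curv[OF offset_not_cong_0]] by blast
  next
    case False
    have "u \<in> {0..1}" using that by simp
    then obtain r where "r \<noteq> 0" "D css_path u
        = (r * pair_diff offset log_curv' (fst_angle u)) *\<^sub>R chord u"
      using False by (rule css_velocity)
    then show ?thesis using False chord_neq_0 by simp
  qed
  then show ?thesis unfolding css_cusps_def by blast
qed

lemma odd_card_css_cusps_iff: "odd (card (css_cusps f \<gamma>)) \<longleftrightarrow> k = int n"
proof -
  have "even (card {x \<in> fst_angle ` {0..<1}. pair_diff offset log_curv' x = 0}) \<longleftrightarrow> monodromy k = 1"
    by (rule simple_zeros.even_card_zeros_quasiperiodic_iff[OF simple_zeros_log_curv'[OF offset_not_cong_0]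
          sweep_pos log_curv'_diff_plus_sweep monodromy_cases fundamental_domain_fst_angle])
  then show ?thesis
    unfolding css_cusps_eq card_fst_angle_vimage[of "\<lambda>x. pair_diff offset log_curv' x = 0"]
    by (simp add: monodromy_def)
qed

lemma card_wc_cusps_le_card_css_cusps:
  assumes "odd k"
  shows "card (wc_cusps f \<gamma>) \<le> card (css_cusps f \<gamma>)"
proof -
  have "wc_cusps f \<gamma> = {u \<in> {0..<1}. pair_diff offset log_curv (fst_angle u) = 0}"
    using wigner_velocity_eq_0_iff[OF _ assms] unfolding wc_cusps_def by auto
  moreover have "card {x \<in> fst_angle ` {0..<1}. pair_diff offset log_curv x = 0}
      \<le> card {x \<in> fst_angle ` {0..<1}. pair_diff offset log_curv' x = 0}"
    using monodromy_cases
    by (intro card_zeros_le_card_deriv_zeros_periodic[OF pair_diff_deriv[OF log_curv_deriv]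
          simple_zeros.finite_zeros[OF simple_zeros_log_curv'[OF offset_not_cong_0] compact_Icc]
          sweep_pos _ _ fundamental_domain_fst_angle])
      (auto simp: log_curv_diff_plus_sweep log_curv'_diff_plus_sweep)
  ultimately show ?thesis
    using card_fst_angle_vimage[of "\<lambda>x. pair_diff offset log_curv x = 0"]
      card_fst_angle_vimage[of "\<lambda>x. pair_diff offset log_curv' x = 0"] by (simp only: css_cusps_eq)
qed

subsection \<open>The normal field\<close>

lemma continuous_chord: "continuous_on {0..1} chord"
proof -
  have point: "continuous_on UNIV point"
    by (intro continuous_at_imp_continuous_on ballI has_vector_derivative_continuous[OF point_deriv])
  show ?thesis
    unfolding chord_def pair_diff_def
    by (intro continuous_intros continuous_on_compose2[OF point] continuous_fst_angle) auto
qed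

lemma chord_1: "chord 1 = of_real (monodromy k) * chord 0"
proof (cases "fst_angle 0 \<le> fst_angle 1")
  case True
  then have "fst_angle 1 = fst_angle 0 + sweep k" using fst_angle_ends by simp
  then show ?thesis by (simp add: chord_def point_diff_plus_sweep)
next
  case False
  then have "fst_angle 0 = fst_angle 1 + sweep k" using fst_angle_ends by simp
  then show ?thesis
    using monodromy_cases by (auto simp: chord_def point_diff_plus_sweep)
qed

lemma normal_lift_exists: "\<exists>\<phi>. normal_lift f \<gamma> \<phi>"
proof -
  obtain \<phi> where orthogonal: "continuous_on {0..1} \<phi>" "\<And>u. u \<in> {0..1} \<Longrightarrow> Re (cnj (cis (\<phi> u)) * chord u) = 0"
    using orthogonal_angle_exists[OF continuous_chord
        convex_imp_contractible[OF convex_real_interval(5)] chord_neq_0]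
    by blast
  have "Re (cnj (cis (\<phi> u)) * D css_path u) = 0"
    if u_in: "u \<in> {0..1}" "ksum_path u \<noteq> 0" for u
  proof -
    obtain r where "D css_path u
        = (r * pair_diff offset log_curv' (fst_angle u)) *\<^sub>R chord u"
      by (rule css_velocity[OF u_in])
    then show ?thesis
      using orthogonal(2)[OF u_in(1)] by (simp only: mult_scaleR_right scaleR_complex.sel mult_zero_right)
  qed
  then have "normal_lift f \<gamma> \<phi>"
    unfolding normal_lift_def by (intro conjI ballI impI orthogonal(1))
  then show ?thesis by blast
qed

lemma finite_fst_angle_zeros:
  assumes "simple_zeros h h'"
  shows "finite {u \<in> {0..1}. h (fst_angle u) = 0}"
proof -
  let ?Z = "{u \<in> {0..<1}. h (fst_angle u) = 0}"
  have "finite {x \<in> fst_angle ` {0..1}. h x = 0}"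
    using simple_zeros.finite_zeros[OF assms] compact_continuous_image[OF continuous_fst_angle] by blast
  then have "finite (fst_angle ` ?Z)" by (rule finite_subset[rotated]) auto
  moreover have "inj_on fst_angle ?Z" by (rule inj_onI) (auto intro: fst_angle_inj simp: rcong_def)
  ultimately have "finite ?Z" by (rule finite_imageD)
  then show ?thesis by (rule finite_subset[rotated, OF finite.insertI[of _ 1]]) auto
qed

lemma finite_asymptotes: "finite {u \<in> {0..1}. ksum_path u = 0}"
proof (cases "even offset")
  case True
  have "{u \<in> {0..1}. ksum_path u = 0} \<subseteq> {u \<in> {0..1}. pair_diff offset log_curv (fst_angle u) = 0}"
    using ksum_eq_0_iff[OF snd_gamma_eq] by (auto simp: fst_angle_def)
  then show ?thesis
    by (rule finite_subset) (rule finite_fst_angle_zeros[OF simple_zeros_log_curv[OF offset_not_cong_0 True]])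
next
  case False
  then have "{u \<in> {0..1}. ksum_path u = 0} = {}" using ksum_eq_0_iff[OF snd_gamma_eq] by blast
  then show ?thesis by (simp only: finite.emptyI)
qed

text \<open>A normal field is constrained neither at the asymptotes nor at the cusps, where the velocity vanishes,
  but both are isolated.\<close>

lemma normal_lift_orthogonal_chord:
  assumes lift: "normal_lift f \<gamma> \<phi>" and u_in: "u \<in> {0..1}"
  shows "Re (cnj (cis (\<phi> u)) * chord u) = 0"
proof -
  let ?w = "\<lambda>u. Re (cnj (cis (\<phi> u)) * chord u)"
  let ?cusps = "{u \<in> {0..1}. pair_diff offset log_curv' (fst_angle u) = 0}"
    and ?asymptotes = "{u \<in> {0..1}. ksum_path u = 0}"
  have "?w v = 0" if v_in: "v \<in> {0..1}" "v \<notin> ?cusps" "v \<notin> ?asymptotes" for v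
  proof -
    have no_cusp: "pair_diff offset log_curv' (fst_angle v) \<noteq> 0"
      and ksum: "ksum_path v \<noteq> 0" using v_in by simp_all
    obtain r where velocity: "r \<noteq> 0"
      "D css_path v = (r * pair_diff offset log_curv' (fst_angle v)) *\<^sub>R chord v"
      by (rule css_velocity[OF v_in(1) ksum])
    have "Re (cnj (cis (\<phi> v)) * D css_path v) = 0"
      by (rule lift[unfolded normal_lift_def, THEN conjunct2, rule_format, OF v_in(1) ksum])
    then show ?thesis
      using velocity(1) no_cusp
      by (simp only: velocity(2) mult_scaleR_right scaleR_complex.sel mult_eq_0_iff simp_thms)
  qed
  then have "{v \<in> {0..1}. ?w v \<noteq> 0} \<subseteq> ?cusps \<union> ?asymptotes" by blast
  moreover have "finite ?cusps"
    by (rule finite_fst_angle_zeros[OF simple_zeros_log_curv'[OF offset_not_cong_0]])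
  moreover note finite_asymptotes
  ultimately have "finite {v \<in> {0..1}. ?w v \<noteq> 0}" by (meson finite_UnI finite_subset)
  moreover have "continuous_on {0..1} ?w"
    using lift unfolding normal_lift_def by (intro continuous_intros continuous_chord) blast+
  ultimately show ?thesis
    using continuous_on_constant_off_finite[of "{0..1}" u "if u = 0 then 1 else 0" ?w 0] u_in
    by (auto split: if_splits)
qed

lemma normal_lift_turn:
  assumes "normal_lift f \<gamma> \<phi>"
  shows "cis (\<phi> 1 - \<phi> 0) = of_real (monodromy k)"
proof (rule orthogonal_angle_turn[of "{0..1}" 0 1 chord])
  show "continuous_on {0..1} \<phi>" using assms by (simp add: normal_lift_def)
  show "Re (cnj (cis (\<phi> u)) * chord u) = 0" if "u \<in> {0..1}" for u
    by (rule normal_lift_orthogonal_chord[OF assms that])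
  show "\<bar>monodromy k\<bar> = 1" using monodromy_cases by auto
qed (auto simp: continuous_chord chord_neq_0 chord_1)

end

context generic_rosette_angle
begin

lemma trav_traversal:
  assumes "k \<in> {1..int n}"
  shows "generic_rosette_traversal f n \<theta> \<tau> k (trav f (branch k))"
proof unfold_locales
  show "traversal f (branch k) (trav f (branch k))"
    unfolding trav_def by (rule someI[of "traversal f (branch k)", OF traversal_angle_path[OF assms]])
qed (use assms in auto)

lemma css_rot_turn:
  assumes "k \<in> {1..int n}"
  shows "cis (2 * pi * css_rot f (branch k)) = of_real (monodromy k)"
proof -
  note trav = trav_traversal[OF assms]
  have "normal_lift f (trav f (branch k)) (SOME \<phi>. normal_lift f (trav f (branch k)) \<phi>)"
    by (rule someI_ex[OF generic_rosette_traversal.normal_lift_exists[OF trav]])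
  from generic_rosette_traversal.normal_lift_turn[OF trav this] show ?thesis
    by (simp add: css_rot_def Let_def)
qed

lemma
  assumes "k \<in> {1..int n}"
  shows odd_css_cusp_count_iff: "odd (css_cusp_count f (branch k)) \<longleftrightarrow> k = int n"
    and css_rot_integer_iff: "css_rot f (branch k) \<in> \<int> \<longleftrightarrow> k \<noteq> int n"
    and css_rot_half_integer_iff: "css_rot f (branch k) - 1/2 \<in> \<int> \<longleftrightarrow> k = int n"
    and wc_cusp_count_le_css_cusp_count: "odd k \<Longrightarrow> wc_cusp_count f (branch k) \<le> css_cusp_count f (branch k)"
proof -
  note trav = trav_traversal[OF assms]
  show "odd (css_cusp_count f (branch k)) \<longleftrightarrow> k = int n"
    unfolding css_cusp_count_def by (rule generic_rosette_traversal.odd_card_css_cusps_iff[OF trav])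
  show "wc_cusp_count f (branch k) \<le> css_cusp_count f (branch k)" if "odd k"
    unfolding css_cusp_count_def wc_cusp_count_def
    by (rule generic_rosette_traversal.card_wc_cusps_le_card_css_cusps[OF trav that])
  show "css_rot f (branch k) \<in> \<int> \<longleftrightarrow> k \<noteq> int n" "css_rot f (branch k) - 1/2 \<in> \<int> \<longleftrightarrow> k = int n"
    using css_rot_turn[OF assms] cis_2pi_eq_1_iff cis_2pi_eq_minus_1_iff
    by (auto simp: monodromy_def split: if_splits)
qed

end

theorem theorem4p18:
  fixes f :: "real \<Rightarrow> complex" and n :: nat
  assumes "generic_rosette f n"
  shows "card (branches f) = n
    \<and> card {B \<in> branches f. odd (css_cusp_count f B)} = 1
    \<and> card {B \<in> branches f. css_rot f B \<in> \<int>} = n - 1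
    \<and> card {B \<in> branches f. css_rot f B - 1/2 \<in> \<int>} = 1
    \<and> card {B \<in> branches f. has_asymptote f B} = n div 2
    \<and> (\<forall>B \<in> branches f. \<not> has_asymptote f B \<longrightarrow> wc_cusp_count f B \<le> css_cusp_count f B)"
proof -
  have "rosette f n" using assms by (simp add: generic_rosette_def)
  then obtain \<theta> \<tau> where "rosette_angle f n \<theta> \<tau>" by (rule rosette_angle_exists)
  then interpret generic_rosette_angle f n \<theta> \<tau>
    using assms by (simp add: generic_rosette_angle_def generic_rosette_angle_axioms_def)
  have last: "{k \<in> {1..int n}. k = int n} = {int n}" and rest: "{k \<in> {1..int n}. k \<noteq> int n} = {1..int n - 1}"
    using n_pos by auto
  have "card (branches f) = n"
    by (simp add: branches_eq card_image[OF inj_on_branch])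
  moreover have "card {B \<in> branches f. odd (css_cusp_count f B)} = card {k \<in> {1..int n}. k = int n}"
    by (intro card_branches_filter odd_css_cusp_count_iff)
  moreover have "card {B \<in> branches f. css_rot f B \<in> \<int>} = card {k \<in> {1..int n}. k \<noteq> int n}"
    by (intro card_branches_filter css_rot_integer_iff)
  moreover have "card {B \<in> branches f. css_rot f B - 1/2 \<in> \<int>} = card {k \<in> {1..int n}. k = int n}"
    by (intro card_branches_filter css_rot_half_integer_iff)
  moreover have "card {B \<in> branches f. has_asymptote f B} = card {k \<in> {1..int n}. even k}"
    by (intro card_branches_filter has_asymptote_iff)
  moreover have "\<forall>B \<in> branches f. \<not> has_asymptote f B \<longrightarrow> wc_cusp_count f B \<le> css_cusp_count f B"
    by (simp add: branches_eq has_asymptote_iff wc_cusp_count_le_css_cusp_count)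
  ultimately show ?thesis unfolding last rest card_even_int_Icc by simp
qed

end
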